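(* For every $c\in\mathbb{R}$, the equation $u_t=u_{xx}+cu_x-xu-u^3$ on $x\in\mathbb{R}$ has a unique monotonically decreasing stationary solution $u_*(x;c)$, i.e. a unique monotonically decreasing solution of $$u_{xx}+cu_x-xu-u^3=0,\qquad x\in\mathbb{R},$$ with the properties that $$\lim_{x\to-\infty}\left(u_*(x;c)-\sqrt{-x}\right)=0,\qquad \lim_{x\to\infty}u_*(x;c)=0.$$
   Context: All functions are real-valued. A stationary solution of $u_t=u_{xx}+cu_x-xu-u^3$ is a time-independent solution $u=u(x)$ defined for all $x\in\mathbb{R}$. *)

theory Defs
  imports Complex_Main
begin

text \<open>Classical solutions, for all times and all of the real line; the witnesses
  are the partial derivatives $w_t$, $w_x$, $w_{xx}$.\<close>

definition pde_solution :: "real \<Rightarrow> (real \<Rightarrow> real \<Rightarrow> real) \<Rightarrow> bool" where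
  "pde_solution c w \<longleftrightarrow>
     (\<exists>wt wx wxx. \<forall>t x.
        ((\<lambda>s. w s x) has_real_derivative wt t x) (at t) \<and>
        ((\<lambda>y. w t y) has_real_derivative wx t x) (at x) \<and>
        ((\<lambda>y. wx t y) has_real_derivative wxx t x) (at x) \<and>
        wt t x = wxx t x + c * wx t x - x * w t x - w t x ^ 3)"

definition stationary_solution :: "real \<Rightarrow> (real \<Rightarrow> real) \<Rightarrow> bool" where
  "stationary_solution c u \<longleftrightarrow> pde_solution c (\<lambda>t x. u x)"

lemma stationary_solution_iff_ode:
  "stationary_solution c u \<longleftrightarrow>
     (\<exists>u' u''. \<forall>x.
        (u has_real_derivative u' x) (at x) \<and>
        (u' has_real_derivative u'' x) (at x) \<and>
        u'' x + c * u' x - x * u x - u x ^ 3 = 0)" (is "?L \<longleftrightarrow> ?R")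
proof
  assume ?L
  then obtain wt wx wxx where w: "\<And>t x.
        ((\<lambda>s. u x) has_real_derivative wt t x) (at t) \<and>
        ((\<lambda>y. u y) has_real_derivative wx t x) (at x) \<and>
        ((\<lambda>y. wx t y) has_real_derivative wxx t x) (at x) \<and>
        wt t x = wxx t x + c * wx t x - x * u x - u x ^ 3"
    unfolding stationary_solution_def pde_solution_def by blast
  have "wt t x = 0" for t x :: real
    using w DERIV_const DERIV_unique by blast
  then have "\<forall>x. (u has_real_derivative wx 0 x) (at x) \<and>
        (wx 0 has_real_derivative wxx 0 x) (at x) \<and>
        wxx 0 x + c * wx 0 x - x * u x - u x ^ 3 = 0"
    using w by metis
  then show ?R by blast
next
  assume ?R
  then obtain u' u'' where "\<forall>x.
        (u has_real_derivative u' x) (at x) \<and>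
        (u' has_real_derivative u'' x) (at x) \<and>
        u'' x + c * u' x - x * u x - u x ^ 3 = 0" by blast
  then show ?L
    unfolding stationary_solution_def pde_solution_def
    by (intro exI[of _ "\<lambda>t x. 0"] exI[of _ "\<lambda>t. u'"] exI[of _ "\<lambda>t. u''"]) simp
qed

end

theory Submission
  imports Defs "HOL-Analysis.Analysis" "HOL-Real_Asymp.Real_Asymp"
begin

text \<open>
  Write the equation as \<open>u'' + c u' = x u + u\<^sup>3\<close>. Uniqueness, monotonicity and the a priori
  bounds all come from one comparison principle for positive functions. If \<open>p\<close> is a subsolution,
  \<open>q > 0\<close> a supersolution and \<open>W = exp (c x) (p' q - p q')\<close>, then
  \<open>(p / q)' = W / (exp (c x) q\<^sup>2)\<close>, and wherever \<open>p > q\<close> one has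
  \<open>W' \<ge> exp (c x) p q (p\<^sup>2 - q\<^sup>2) \<ge> 0\<close>. Hence, once the ratio exceeds 1 and increases,
  it keeps doing so for ever to the right. The linear part \<open>x u\<close>, which has the wrong sign for the
  usual maximum principle when \<open>x < 0\<close>, cancels in \<open>W'\<close>; this is why ratios and not
  differences are compared. On a bounded interval the conclusion contradicts \<open>p \<le> q\<close> at
  the right end (\<open>comparison_bounded_interval\<close>). On the whole line, with \<open>p / q \<rightarrow> 1\<close> at
  \<open>-\<infinity>\<close> and \<open>p \<rightarrow> 0\<close> at \<open>\<infinity>\<close>, the lower bound \<open>W \<ge> \<delta> > 0\<close> together with
  the boundedness of \<open>exp (c x) p\<close> forces \<open>q'\<close> below a negative constant, so \<open>q\<close> would
  become negative (\<open>comparison_real_line\<close>).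

  Two solutions asymptotic to \<open>sqrt (- x)\<close> have ratio tending to 1, so uniqueness follows at
  once. Monotonicity is the same comparison: for \<open>h \<ge> 0\<close> the translate \<open>u (x + h)\<close> is a
  subsolution, since \<open>(x + h) u \<ge> x u\<close>, and therefore lies below \<open>u\<close>.

  For existence, the Dirichlet problem on a bounded interval is solved by monotone iteration,
  starting from a large constant. The boundary values are taken from the global supersolution
  \<open>\<psi> = sqrt (ln (1 + exp (a - x)))\<close> with \<open>a = (1 + \<bar>c\<bar>) / 2\<close>, a smoothing of \<open>sqrt (a - x)\<close>
  that decays at \<open>\<infinity>\<close>. Comparison shows that the solutions on growing intervals decrease, and
  they are kept away from 0 by two subsolutions: a bump \<open>exp (- c (x + L) / 2) cos (x + L)\<close> far
  to the left, which yields \<open>u (- L) \<ge> 1\<close>, and then \<open>sqrt (- b - x)\<close> on the half-line left of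
  \<open>- L = - b - 1\<close>, whose value at \<open>- L\<close> is 1. The limit is trapped between \<open>sqrt (- b - x)\<close> and
  \<open>\<psi>\<close> on the left, which gives the asymptotics there, and between 0 and \<open>\<psi>\<close> on the right.
\<close>

section \<open>Equations of the form u'' + c u' = f\<close>

text \<open>
  The derivative is fixed to be \<open>deriv u\<close>, so that solutions on overlapping intervals can be
  glued without matching existentially quantified derivatives.
\<close>

definition drift_ode :: "real \<Rightarrow> real set \<Rightarrow> (real \<Rightarrow> real) \<Rightarrow> (real \<Rightarrow> real) \<Rightarrow> bool" where
  "drift_ode c S u f \<longleftrightarrow>
     (\<forall>x\<in>S. (u has_real_derivative deriv u x) (at x) \<and>
            (deriv u has_real_derivative f x - c * deriv u x) (at x))"

lemma drift_odeI:
  assumes "open S"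
    and "\<And>x. x \<in> S \<Longrightarrow> (u has_real_derivative u' x) (at x)"
    and "\<And>x. x \<in> S \<Longrightarrow> (u' has_real_derivative f x - c * u' x) (at x)"
  shows "drift_ode c S u f"
  unfolding drift_ode_def
proof (intro ballI conjI)
  have eq: "deriv u y = u' y" if "y \<in> S" for y
    using assms(2)[OF that] by (rule DERIV_imp_deriv)
  fix x assume x: "x \<in> S"
  show "(u has_real_derivative deriv u x) (at x)"
    using assms(2)[OF x] eq[OF x] by simp
  show "(deriv u has_real_derivative f x - c * deriv u x) (at x)"
    using has_field_derivative_transform_within_open[OF assms(3)[OF x] \<open>open S\<close> x] eq
    by (metis x)
qed

lemma drift_odeD:
  assumes "drift_ode c S u f" "x \<in> S"
  shows "(u has_real_derivative deriv u x) (at x)"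
    and "(deriv u has_real_derivative f x - c * deriv u x) (at x)"
  using assms unfolding drift_ode_def by auto

lemma drift_ode_subset: "drift_ode c S u f \<Longrightarrow> T \<subseteq> S \<Longrightarrow> drift_ode c T u f"
  unfolding drift_ode_def by auto

lemma drift_ode_cong:
  "drift_ode c S u f \<Longrightarrow> (\<And>x. x \<in> S \<Longrightarrow> f x = g x) \<Longrightarrow> drift_ode c S u g"
  unfolding drift_ode_def by auto

lemma drift_ode_continuous_on: "drift_ode c S u f \<Longrightarrow> continuous_on S u"
  unfolding drift_ode_def by (meson DERIV_isCont continuous_at_imp_continuous_on)

lemma drift_ode_diff:
  assumes "open S" "drift_ode c S u f" "drift_ode c S v g"
  shows "drift_ode c S (\<lambda>x. u x - v x) (\<lambda>x. f x - g x)"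
  by (rule drift_odeI[OF assms(1), where u' = "\<lambda>x. deriv u x - deriv v x"])
     (auto intro!: derivative_eq_intros drift_odeD[OF assms(2)] drift_odeD[OF assms(3)]
       simp: algebra_simps)

lemma drift_ode_shift:
  assumes "drift_ode c UNIV u f"
  shows "drift_ode c UNIV (\<lambda>x. u (x + h)) (\<lambda>x. f (x + h))"
proof (rule drift_odeI[where u' = "\<lambda>x. deriv u (x + h)"])
  fix x
  show "((\<lambda>x. u (x + h)) has_real_derivative deriv u (x + h)) (at x)"
    using drift_odeD(1)[OF assms, of "x + h"] by (simp add: DERIV_shift)
  show "((\<lambda>x. deriv u (x + h)) has_real_derivative f (x + h) - c * deriv u (x + h)) (at x)"
    using drift_odeD(2)[OF assms, of "x + h"] by (simp add: DERIV_shift)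
qed simp

lemma interior_min_deriv_zero:
  fixes u :: "real \<Rightarrow> real"
  assumes "(u has_real_derivative l) (at x)" "a < x" "x < b"
    and "\<And>y. a < y \<Longrightarrow> y < b \<Longrightarrow> u x \<le> u y"
  shows "l = 0"
proof (rule DERIV_local_min[OF assms(1)])
  show "0 < min (x - a) (b - x)" using assms by simp
  show "\<forall>y. \<bar>x - y\<bar> < min (x - a) (b - x) \<longrightarrow> u x \<le> u y"
    using assms(4) by (auto simp: abs_if split: if_splits)
qed

section \<open>The linear Dirichlet problem\<close>

text \<open>
  At a negative interior minimum the equation would make the second derivative negative, so the
  function would decrease to the right of its minimum.
\<close>

lemma linear_minimum_principle:
  assumes "A < B" "K > 0" "continuous_on {A..B} w" "drift_ode c {A<..<B} w f"
    and super: "\<And>x. A < x \<Longrightarrow> x < B \<Longrightarrow> f x \<le> K * w x"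
    and bdry: "w A \<ge> 0" "w B \<ge> 0" and x: "x \<in> {A..B}"
  shows "w x \<ge> 0"
proof (rule ccontr)
  assume neg: "\<not> w x \<ge> 0"
  obtain m where m: "m \<in> {A..B}" "\<And>y. y \<in> {A..B} \<Longrightarrow> w m \<le> w y"
    using continuous_attains_inf[OF compact_Icc _ assms(3)] \<open>A < B\<close> by auto
  have wm: "w m < 0" using m(2)[OF x] neg by simp
  have mi: "A < m" "m < B" using m(1) wm bdry by (auto simp: less_le)
  note D = drift_odeD[OF assms(4), of m]
  have d0: "deriv w m = 0"
    by (rule interior_min_deriv_zero[OF D(1)]) (use mi m in auto)
  have "f m < 0" using super[OF mi] wm \<open>K > 0\<close> by (smt (verit) mult_pos_neg)
  then obtain d where d: "d > 0" "\<And>h. 0 < h \<Longrightarrow> h < d \<Longrightarrow> deriv w (m + h) < deriv w m"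
    using DERIV_neg_dec_right[of "deriv w" "f m" m] D(2) mi d0 by auto
  define y where "y = min (m + d / 2) ((m + B) / 2)"
  have y: "m < y" "y < B" "y < m + d" unfolding y_def using d mi by (auto simp: min_def)
  have "w m > w y"
  proof (rule DERIV_neg_imp_decreasing_open[OF y(1)])
    fix z assume z: "m < z" "z < y"
    then have "deriv w z < 0" using d(2)[of "z - m"] y d0 by auto
    then show "\<exists>l. (w has_real_derivative l) (at z) \<and> l < 0"
      using drift_odeD(1)[OF assms(4), of z] z y mi by auto
  qed (use assms(3) y mi in \<open>auto intro: continuous_on_subset\<close>)
  then show False using m(2)[of y] y mi by auto
qed

text \<open>
  Variation of constants: \<open>l1\<close> and \<open>l2\<close> are the two real roots of
  \<open>l\<^sup>2 + c l - K = 0\<close>. A particular solution vanishing at \<open>A\<close> is corrected by a combination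
  of exponentials, and the boundary conditions determine the combination because the roots differ.
\<close>

lemma linear_dirichlet_problem:
  assumes "A < B" "K > 0" and f: "continuous_on {A..B} f"
  shows "\<exists>w. continuous_on {A..B} w \<and> drift_ode c {A<..<B} w (\<lambda>x. K * w x + f x) \<and>
             w A = \<alpha> \<and> w B = \<beta>"
proof -
  define r where "r = sqrt (c\<^sup>2 + 4 * K)"
  define l1 where "l1 = (r - c) / 2"
  define l2 where "l2 = (- r - c) / 2"
  have r: "r > 0" "r\<^sup>2 = c\<^sup>2 + 4 * K" unfolding r_def using \<open>K > 0\<close> by (auto simp: add_nonneg_pos)
  have l: "l1\<^sup>2 = K - c * l1" "l2\<^sup>2 = K - c * l2" "l1 - l2 = r"
    using r(2) unfolding l1_def l2_def by (auto simp: power2_eq_square field_simps)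
  have cont: "continuous_on {A..B} (\<lambda>t. exp (- l * t) * f t)" for l
    by (intro continuous_intros f)
  define F where "F = (\<lambda>l x. integral {A..x} (\<lambda>t. exp (- l * t) * f t))"
  have Fd: "(F l has_real_derivative exp (- l * x) * f x) (at x)" if "A < x" "x < B" for l x
  proof -
    have "(F l has_real_derivative exp (- l * x) * f x) (at x within {A..B})"
      unfolding F_def by (rule integral_has_real_derivative[OF cont]) (use that in auto)
    then show ?thesis using that by (simp add: at_within_Icc_at)
  qed
  have Fc: "continuous_on {A..B} (F l)" for l
    unfolding F_def by (intro indefinite_integral_continuous_1 integrable_continuous_real cont)
  define yp where "yp = (F l1 B * exp (l1 * B) - F l2 B * exp (l2 * B)) / r"
  define E1 where "E1 = exp (l1 * (B - A))"
  define E2 where "E2 = exp (l2 * (B - A))"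
  define P where "P = (\<beta> - yp - \<alpha> * E2) / (E1 - E2)"
  define Q where "Q = \<alpha> - P"
  have "E1 > E2" unfolding E1_def E2_def using l(3) r(1) \<open>A < B\<close> by auto
  define w where "w = (\<lambda>x. (F l1 x * exp (l1 * x) - F l2 x * exp (l2 * x)) / r
                         + P * exp (l1 * (x - A)) + Q * exp (l2 * (x - A)))"
  define w' where "w' = (\<lambda>x. (F l1 x * (l1 * exp (l1 * x)) - F l2 x * (l2 * exp (l2 * x))) / r
                         + P * (l1 * exp (l1 * (x - A))) + Q * (l2 * exp (l2 * (x - A))))"
  have "w A = \<alpha>" unfolding w_def F_def Q_def by simp
  moreover have "w B = \<beta>"
  proof -
    have "w B = yp + P * E1 + Q * E2" unfolding w_def yp_def E1_def E2_def by simp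
    also have "\<dots> = yp + \<alpha> * E2 + P * (E1 - E2)" unfolding Q_def by (simp add: algebra_simps)
    also have "\<dots> = \<beta>" unfolding P_def using \<open>E1 > E2\<close> by simp
    finally show ?thesis .
  qed
  moreover have "continuous_on {A..B} w"
    unfolding w_def using r(1) by (intro continuous_intros Fc) auto
  moreover have "drift_ode c {A<..<B} w (\<lambda>x. K * w x + f x)"
  proof (rule drift_odeI[where u' = w'])
    fix x assume "x \<in> {A<..<B}"
    then have x: "A < x" "x < B" by auto
    have e: "exp (- l * x) * f x * exp (l * x) = f x" for l
      by (simp add: exp_minus field_simps)
    have "(w has_real_derivative
        ((exp (- l1 * x) * f x * exp (l1 * x) + F l1 x * (exp (l1 * x) * l1))
         - (exp (- l2 * x) * f x * exp (l2 * x) + F l2 x * (exp (l2 * x) * l2))) / r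
        + P * (exp (l1 * (x - A)) * l1) + Q * (exp (l2 * (x - A)) * l2)) (at x)"
      unfolding w_def using r(1)
      by (auto intro!: derivative_eq_intros Fd x simp: field_simps)
    then show "(w has_real_derivative w' x) (at x)"
      unfolding e w'_def by (simp add: algebra_simps)
    have "(w' has_real_derivative
        ((exp (- l1 * x) * f x * exp (l1 * x) * l1 + F l1 x * (exp (l1 * x) * l1\<^sup>2))
         - (exp (- l2 * x) * f x * exp (l2 * x) * l2 + F l2 x * (exp (l2 * x) * l2\<^sup>2))) / r
        + P * (exp (l1 * (x - A)) * l1\<^sup>2) + Q * (exp (l2 * (x - A)) * l2\<^sup>2)) (at x)"
      unfolding w'_def using r(1)
      by (auto intro!: derivative_eq_intros Fd x simp: field_simps power2_eq_square)
    also have "(((exp (- l1 * x) * f x * exp (l1 * x) * l1 + F l1 x * (exp (l1 * x) * l1\<^sup>2))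
         - (exp (- l2 * x) * f x * exp (l2 * x) * l2 + F l2 x * (exp (l2 * x) * l2\<^sup>2))) / r
        + P * (exp (l1 * (x - A)) * l1\<^sup>2) + Q * (exp (l2 * (x - A)) * l2\<^sup>2)) =
        (l1 - l2) * f x / r + K * w x - c * w' x"
      unfolding e l(1,2) w_def w'_def using r(1) by (simp add: field_simps)
    also have "\<dots> = K * w x + f x - c * w' x" using l(3) r(1) by simp
    finally show "(w' has_real_derivative K * w x + f x - c * w' x) (at x)" .
  qed simp
  ultimately show ?thesis by blast
qed

section \<open>Pointwise limits of solutions\<close>

text \<open>
  Integrating the equation twice expresses \<open>u\<close> through integrals of \<open>u\<close> and \<open>h\<close> and a single
  constant \<open>d\<close> that stands for the value of \<open>u' + c u\<close> at the left end. The integrals pass to the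
  limit by dominated convergence; the value at \<open>B\<close> then forces \<open>d\<close> to converge as well. The
  limiting identity returns first continuity, then differentiability. Continuity of \<open>g\<close> is only
  demanded once \<open>v\<close> is known to be continuous, because in the applications \<open>g\<close> is a function of
  \<open>v\<close>.
\<close>

lemma drift_ode_limit:
  assumes "A < B"
    and uc: "\<And>k. continuous_on {A..B} (u k)" and hc: "\<And>k. continuous_on {A..B} (h k)"
    and ode: "\<And>k::nat. drift_ode c {A<..<B} (u k) (h k)"
    and ub: "\<And>k x. x \<in> {A..B} \<Longrightarrow> \<bar>u k x\<bar> \<le> M" and hb: "\<And>k x. x \<in> {A..B} \<Longrightarrow> \<bar>h k x\<bar> \<le> M"
    and ul: "\<And>x. x \<in> {A..B} \<Longrightarrow> (\<lambda>k. u k x) \<longlonglongrightarrow> v x"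
    and hl: "\<And>x. x \<in> {A..B} \<Longrightarrow> (\<lambda>k. h k x) \<longlonglongrightarrow> g x"
    and gc: "continuous_on {A..B} v \<Longrightarrow> continuous_on {A..B} g"
  shows "continuous_on {A..B} v \<and> drift_ode c {A<..<B} v g"
proof -
  define H where "H = (\<lambda>k x. integral {A..x} (h k))"
  define G where "G = (\<lambda>x. integral {A..x} g)"
  have sub: "{A..x} \<subseteq> {A..B}" if "x \<in> {A..B}" for x using that by auto
  have ui: "(u k) integrable_on {A..x}" if "x \<in> {A..B}" for k x
    by (rule integrable_continuous_real[OF continuous_on_subset[OF uc sub[OF that]]])
  have hi: "(h k) integrable_on {A..x}" if "x \<in> {A..B}" for k x
    by (rule integrable_continuous_real[OF continuous_on_subset[OF hc sub[OF that]]])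
  have Hc: "continuous_on {A..B} (H k)" for k
    unfolding H_def using assms(1) by (intro indefinite_integral_continuous_1 hi) auto
  have Hi: "(H k) integrable_on {A..x}" if "x \<in> {A..B}" for k x
    by (rule integrable_continuous_real[OF continuous_on_subset[OF Hc sub[OF that]]])
  have at: "((\<lambda>x. integral {A..x} f) has_real_derivative f x) (at x)"
    if "continuous_on {A..B} f" "A < x" "x < B" for f :: "real \<Rightarrow> real" and x
    using integral_has_real_derivative[OF that(1), of x] that by (simp add: at_within_Icc_at)
  have "\<exists>d. \<forall>x\<in>{A..B}. u k x = u k A + d * (x - A) + integral {A..x} (H k) - c * integral {A..x} (u k)" for k
  proof -
    let ?p = "\<lambda>x. deriv (u k) x + c * u k x - H k x"
    define m where "m = (A + B) / 2"
    have m: "A < m" "m < B" using assms(1) by (auto simp: m_def)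
    have D0: "(?p has_real_derivative 0) (at x)" if "x \<in> {A<..<B}" for x
      unfolding H_def using that
      by (auto intro!: derivative_eq_intros drift_odeD[OF ode that] at[OF hc])
    have p: "?p x = ?p m" if "x \<in> {A<..<B}" for x
      by (rule DERIV_isconst3[OF assms(1) that _ D0]) (use m in auto)
    let ?q = "\<lambda>x. u k x + c * integral {A..x} (u k) - ?p m * (x - A) - integral {A..x} (H k)"
    have q: "?q x = ?q A" if "x \<in> {A..B}" for x
    proof (rule DERIV_isconst2[OF assms(1)])
      show "continuous_on {A..B} ?q"
        using assms(1) by (intro continuous_intros uc indefinite_integral_continuous_1 ui Hi) auto
      fix y assume y: "A < y" "y < B"
      have "(?q has_real_derivative deriv (u k) y + c * u k y - ?p m - H k y) (at y)"
        using y by (auto intro!: derivative_eq_intros drift_odeD(1)[OF ode] at[OF uc] at[OF Hc])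
      then show "(?q has_real_derivative 0) (at y)"
        by (rule DERIV_cong) (use p[of y] y in auto)
    qed (use that in auto)
    show ?thesis
      by (rule exI[of _ "?p m"]) (use q in \<open>auto simp: algebra_simps\<close>)
  qed
  then obtain d where d: "\<And>k x. x \<in> {A..B} \<Longrightarrow>
      u k x = u k A + d k * (x - A) + integral {A..x} (H k) - c * integral {A..x} (u k)"
    by metis
  have gi: "g integrable_on {A..x}" and Hl: "(\<lambda>k. H k x) \<longlonglongrightarrow> G x" if "x \<in> {A..B}" for x
    unfolding H_def G_def
    using dominated_convergence[of h "{A..x}" "\<lambda>_. M" g] hi[OF that] hb hl sub[OF that]
    by (auto simp: integrable_const_ivl subset_iff)
  have vi: "v integrable_on {A..x}" and Ul: "(\<lambda>k. integral {A..x} (u k)) \<longlonglongrightarrow> integral {A..x} v" if "x \<in> {A..B}" for x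
    using dominated_convergence[of u "{A..x}" "\<lambda>_. M" v] ui[OF that] ub ul sub[OF that]
    by (auto simp: integrable_const_ivl subset_iff)
  have Hb: "\<bar>H k x\<bar> \<le> M * (B - A)" if "x \<in> {A..B}" for k x
  proof -
    have "M \<ge> 0" using ub[of A] assms(1) by force
    have "norm (integral {A..x} (h k)) \<le> integral {A..x} (\<lambda>_. M)"
      by (rule integral_norm_bound_integral)
         (use hi[OF that] hb sub[OF that] in \<open>auto simp: integrable_const_ivl subset_iff\<close>)
    also have "\<dots> \<le> M * (B - A)" using that \<open>M \<ge> 0\<close> 
      by (simp add: mult.commute[of _ M] mult_left_mono)
    finally show ?thesis unfolding H_def by simp
  qed
  have Gi: "G integrable_on {A..x}" and HHl: "(\<lambda>k. integral {A..x} (H k)) \<longlonglongrightarrow> integral {A..x} G" if "x \<in> {A..B}" for x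
    using dominated_convergence[of H "{A..x}" "\<lambda>_. M * (B - A)" G] Hi[OF that] Hb Hl sub[OF that]
    by (auto simp: integrable_const_ivl subset_iff)
  have AB: "A \<in> {A..B}" "B \<in> {A..B}" using assms(1) by auto
  define D where "D = (v B - v A - integral {A..B} G + c * integral {A..B} v) / (B - A)"
  have dk: "d k = (u k B - u k A - integral {A..B} (H k) + c * integral {A..B} (u k)) / (B - A)" for k
    using d[OF AB(2), of k] assms(1) by (simp add: field_simps)
  have dl: "d \<longlonglongrightarrow> D"
    unfolding dk[abs_def] D_def using assms(1)
    by (intro tendsto_intros ul HHl Ul AB) auto
  have v: "v x = v A + D * (x - A) + integral {A..x} G - c * integral {A..x} v" if x: "x \<in> {A..B}" for x
  proof (rule LIMSEQ_unique[OF ul[OF x]])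
    show "(\<lambda>k. u k x) \<longlonglongrightarrow> v A + D * (x - A) + integral {A..x} G - c * integral {A..x} v"
      unfolding d[OF x] by (intro tendsto_intros ul HHl[OF x] Ul[OF x] AB dl)
  qed
  have vc: "continuous_on {A..B} v"
  proof -
    have "continuous_on {A..B} (\<lambda>x. v A + D * (x - A) + integral {A..x} G - c * integral {A..x} v)"
      by (intro continuous_intros indefinite_integral_continuous_1 vi Gi AB)
    then show ?thesis using v by (metis (no_types, lifting) continuous_on_cong)
  qed
  have Gc: "continuous_on {A..B} G"
    unfolding G_def by (intro indefinite_integral_continuous_1 gi AB)
  have "drift_ode c {A<..<B} v g"
  proof (rule drift_odeI[where u' = "\<lambda>x. D + G x - c * v x"])
    fix x assume x: "x \<in> {A<..<B}"
    have "((\<lambda>x. v A + D * (x - A) + integral {A..x} G - c * integral {A..x} v)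
        has_real_derivative D + G x - c * v x) (at x)"
      using x by (auto intro!: derivative_eq_intros at[OF Gc] at[OF vc])
    then show v': "(v has_real_derivative D + G x - c * v x) (at x)"
    proof (rule has_field_derivative_transform_within_open[where S = "{A<..<B}"])
      fix y assume "y \<in> {A<..<B}"
      then show "v A + D * (y - A) + integral {A..y} G - c * integral {A..y} v = v y"
        by (intro v[symmetric]) auto
    qed (use x in auto)
    have "(G has_real_derivative g x) (at x)"
      unfolding G_def using x by (intro at gc vc) auto
    then show "((\<lambda>x. D + G x - c * v x) has_real_derivative g x - c * (D + G x - c * v x)) (at x)"
      using v' by (auto intro!: derivative_eq_intros)
  qed simp
  with vc show ?thesis by blast
qed

section \<open>The nonlinear Dirichlet problem\<close>

text \<open>
  Monotone iteration. With \<open>K\<close> above the derivative of \<open>s \<mapsto> x s + s\<^sup>3\<close> on \<open>[0, M]\<close>, the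
  function \<open>F x s = x s + s\<^sup>3 - K s\<close> is decreasing in \<open>s\<close>, so the solution operator
  \<open>u \<mapsto> w\<close> of \<open>w'' + c w' - K w = F x u\<close> is order preserving. The constant \<open>M\<close> is a
  supersolution because \<open>x + M\<^sup>2 \<ge> 0\<close>, and 0 is a solution, so the iterates decrease
  from \<open>M\<close> and stay nonnegative.
\<close>

lemma nonlinear_dirichlet_problem:
  assumes "A < B" and \<alpha>: "0 < \<alpha>" "\<alpha> \<le> M" and \<beta>: "0 \<le> \<beta>" "\<beta> \<le> M" and M: "0 \<le> A + M\<^sup>2"
  shows "\<exists>u. continuous_on {A..B} u \<and> drift_ode c {A<..<B} u (\<lambda>x. x * u x + u x ^ 3) \<and>
             u A = \<alpha> \<and> u B = \<beta> \<and> (\<forall>x\<in>{A..B}. 0 \<le> u x)"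
proof -
  define K where "K = 1 + \<bar>A\<bar> + \<bar>B\<bar> + 3 * M\<^sup>2"
  define F where "F = (\<lambda>x s::real. x * s + s ^ 3 - K * s)"
  have "K > 0" unfolding K_def by (simp add: add_pos_nonneg)
  have "M \<ge> 0" using \<alpha> by simp
  have Fmono: "F x t \<le> F x s" if "x \<in> {A..B}" "0 \<le> s" "s \<le> t" "t \<le> M" for x s t
  proof -
    have "s\<^sup>2 \<le> M\<^sup>2" "s * t \<le> M * M" "t\<^sup>2 \<le> M\<^sup>2"
      using that \<open>M \<ge> 0\<close> by (auto intro!: power_mono mult_mono)
    moreover have "x \<le> \<bar>B\<bar>" using that(1) by auto
    ultimately have "x + s\<^sup>2 + s * t + t\<^sup>2 \<le> K"
      unfolding K_def power2_eq_square by linarith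
    then have "(t - s) * (x + s\<^sup>2 + s * t + t\<^sup>2 - K) \<le> 0"
      using that by (intro mult_nonneg_nonpos) auto
    moreover have "F x t - F x s = (t - s) * (x + s\<^sup>2 + s * t + t\<^sup>2 - K)"
      unfolding F_def by (simp add: algebra_simps power2_eq_square power3_eq_cube)
    ultimately show ?thesis by simp
  qed
  define next_sol where "next_sol = (\<lambda>u w. continuous_on {A..B} w \<and>
      drift_ode c {A<..<B} w (\<lambda>x. K * w x + F x (u x)) \<and> w A = \<alpha> \<and> w B = \<beta>)"
  have ex: "\<exists>w. next_sol u w" if "continuous_on {A..B} u" for u
    unfolding next_sol_def
    by (rule linear_dirichlet_problem[OF assms(1) \<open>K > 0\<close>])
       (auto simp: F_def intro!: continuous_intros that)
  define u where "u = rec_nat (\<lambda>_. M) (\<lambda>_ v. SOME w. next_sol v w)"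
  have u0: "u 0 = (\<lambda>_. M)" and uS: "u (Suc k) = (SOME w. next_sol (u k) w)" for k
    unfolding u_def by auto
  have uc: "continuous_on {A..B} (u k)" for k
  proof (induction k)
    case (Suc k)
    then show ?case using someI_ex[OF ex[OF Suc]] unfolding uS next_sol_def by blast
  qed (simp add: u0)
  have un: "next_sol (u k) (u (Suc k))" for k
    unfolding uS by (rule someI_ex[OF ex[OF uc]])
  have uode: "drift_ode c {A<..<B} (u (Suc k)) (\<lambda>x. K * u (Suc k) x + F x (u k x))"
    and uA: "u (Suc k) A = \<alpha>" and uB: "u (Suc k) B = \<beta>" for k
    using un[of k] unfolding next_sol_def by auto
  have nonneg_step: "0 \<le> u (Suc k) x"
    if "\<And>y. y \<in> {A..B} \<Longrightarrow> 0 \<le> u k y \<and> u k y \<le> M" "x \<in> {A..B}" for k x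
  proof (rule linear_minimum_principle[OF assms(1) \<open>K > 0\<close> uc uode])
    fix y assume "A < y" "y < B"
    then have "F y (u k y) \<le> F y 0" using that(1)[of y] by (intro Fmono) auto
    then show "K * u (Suc k) y + F y (u k y) \<le> K * u (Suc k) y" by (simp add: F_def)
  qed (use uA uB \<alpha> \<beta> that in auto)
  have mono: "0 \<le> u (Suc k) x \<and> u (Suc k) x \<le> u k x \<and> u k x \<le> M" if "x \<in> {A..B}" for k x
    using that
  proof (induction k arbitrary: x)
    case 0
    have ode0: "drift_ode c {A<..<B} (u 0) (\<lambda>_. 0)"
      unfolding u0 by (rule drift_odeI[where u' = "\<lambda>_. 0"]) auto
    have "0 \<le> u 0 x - u (Suc 0) x"
    proof (rule linear_minimum_principle[OF assms(1) \<open>K > 0\<close>,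
          where w = "\<lambda>x. u 0 x - u (Suc 0) x"])
      show "continuous_on {A..B} (\<lambda>x. u 0 x - u (Suc 0) x)" by (intro continuous_intros uc)
      show "drift_ode c {A<..<B} (\<lambda>x. u 0 x - u (Suc 0) x)
          (\<lambda>x. 0 - (K * u (Suc 0) x + F x (u 0 x)))"
        by (rule drift_ode_diff[OF _ ode0 uode]) simp
      fix y assume "A < y" "y < B"
      then have "0 \<le> M * (y + M\<^sup>2)" using \<open>M \<ge> 0\<close> M by (intro mult_nonneg_nonneg) auto
      then show "0 - (K * u (Suc 0) y + F y (u 0 y)) \<le> K * (u 0 y - u (Suc 0) y)"
        unfolding u0 F_def by (simp add: algebra_simps power2_eq_square power3_eq_cube)
    qed (use uA uB \<alpha> \<beta> 0 u0 in auto)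
    moreover have "0 \<le> u (Suc 0) x" by (rule nonneg_step) (use 0 \<open>M \<ge> 0\<close> u0 in auto)
    ultimately show ?case using u0 by simp
  next
    case (Suc k)
    have "0 \<le> u (Suc k) x - u (Suc (Suc k)) x"
    proof (rule linear_minimum_principle[OF assms(1) \<open>K > 0\<close>,
          where w = "\<lambda>x. u (Suc k) x - u (Suc (Suc k)) x"])
      show "continuous_on {A..B} (\<lambda>x. u (Suc k) x - u (Suc (Suc k)) x)"
        by (intro continuous_intros uc)
      show "drift_ode c {A<..<B} (\<lambda>x. u (Suc k) x - u (Suc (Suc k)) x)
          (\<lambda>x. K * u (Suc k) x + F x (u k x) - (K * u (Suc (Suc k)) x + F x (u (Suc k) x)))"
        by (rule drift_ode_diff[OF _ uode uode]) simp
      fix y assume "A < y" "y < B"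
      then have "F y (u k y) \<le> F y (u (Suc k) y)" using Suc.IH[of y] by (intro Fmono) auto
      then show "K * u (Suc k) y + F y (u k y) - (K * u (Suc (Suc k)) y + F y (u (Suc k) y))
          \<le> K * (u (Suc k) y - u (Suc (Suc k)) y)" by (simp add: algebra_simps)
    qed (use uA uB Suc.prems in auto)
    moreover have "0 \<le> u (Suc (Suc k)) x"
    proof (rule nonneg_step)
      fix y assume "y \<in> {A..B}"
      then show "0 \<le> u (Suc k) y \<and> u (Suc k) y \<le> M" using Suc.IH[of y] by linarith
    qed (use Suc.prems in auto)
    ultimately show ?case using Suc.IH[OF Suc.prems] by linarith
  qed
  have "\<exists>l. (\<lambda>k. u k x) \<longlonglongrightarrow> l" if "x \<in> {A..B}" for x
  proof -
    have "decseq (\<lambda>k. u k x)" using mono[OF that] by (intro decseq_SucI) auto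
    moreover have "\<forall>k. 0 \<le> u k x" using mono[OF that] order_trans by blast
    ultimately show ?thesis by (metis decseq_convergent)
  qed
  then obtain v where v: "\<And>x. x \<in> {A..B} \<Longrightarrow> (\<lambda>k. u k x) \<longlonglongrightarrow> v x" by metis
  have vS: "(\<lambda>k. u (Suc k) x) \<longlonglongrightarrow> v x" if "x \<in> {A..B}" for x
    using v[OF that] by (rule LIMSEQ_Suc)
  have bound: "\<bar>u k x\<bar> \<le> M" if "x \<in> {A..B}" for k x
    using mono[OF that, of k] by auto
  define M' where "M' = K * M + \<bar>A\<bar> * M + \<bar>B\<bar> * M + M ^ 3 + K * M + M"
  have M': "M \<le> M'"
    using \<open>M \<ge> 0\<close> \<open>K > 0\<close> unfolding M'_def by (smt (verit) mult_nonneg_nonneg zero_le_power abs_ge_zero)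
  have "continuous_on {A..B} v \<and> drift_ode c {A<..<B} v (\<lambda>x. K * v x + F x (v x))"
  proof (rule drift_ode_limit[OF assms(1), where u = "\<lambda>k. u (Suc k)" and M = M'])
    show "continuous_on {A..B} (\<lambda>x. K * u (Suc k) x + F x (u k x))" for k
      unfolding F_def by (intro continuous_intros uc)
    show "drift_ode c {A<..<B} (u (Suc k)) (\<lambda>x. K * u (Suc k) x + F x (u k x))" for k
      by (rule uode)
    fix x assume x: "x \<in> {A..B}"
    show "\<bar>u (Suc k) x\<bar> \<le> M'" for k using bound[OF x, of "Suc k"] M' by linarith
    show "\<bar>K * u (Suc k) x + F x (u k x)\<bar> \<le> M'" for k
    proof -
      have "\<bar>K * u (Suc k) x\<bar> \<le> K * M" "\<bar>K * u k x\<bar> \<le> K * M"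
        unfolding abs_mult using \<open>K > 0\<close> bound[OF x] by (auto intro!: mult_mono)
      moreover have "\<bar>x * u k x\<bar> \<le> (\<bar>A\<bar> + \<bar>B\<bar>) * M"
        unfolding abs_mult using x bound[OF x] by (intro mult_mono) auto
      moreover have "\<bar>u k x ^ 3\<bar> \<le> M ^ 3"
        unfolding power_abs using bound[OF x] by (intro power_mono) auto
      ultimately show ?thesis using \<open>M \<ge> 0\<close> unfolding F_def M'_def distrib_right by linarith
    qed
    show "(\<lambda>k. u (Suc k) x) \<longlonglongrightarrow> v x" by (rule vS[OF x])
    show "(\<lambda>k. K * u (Suc k) x + F x (u k x)) \<longlonglongrightarrow> K * v x + F x (v x)"
      unfolding F_def by (intro tendsto_intros v[OF x] vS[OF x])
  next
    assume "continuous_on {A..B} v"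
    then show "continuous_on {A..B} (\<lambda>x. K * v x + F x (v x))"
      unfolding F_def by (intro continuous_intros)
  qed (rule uc)
  then have "continuous_on {A..B} v" "drift_ode c {A<..<B} v (\<lambda>x. x * v x + v x ^ 3)"
    by (auto simp: F_def elim: drift_ode_cong)
  moreover have "v A = \<alpha>" "v B = \<beta>"
    using LIMSEQ_unique[OF vS[of A]] LIMSEQ_unique[OF vS[of B]] assms(1) uA uB by auto
  moreover have "0 \<le> v x" if "x \<in> {A..B}" for x
    by (rule LIMSEQ_le_const[OF vS[OF that]]) (use mono[OF that] in auto)
  ultimately show ?thesis by blast
qed

text \<open>
  A zero of a nonnegative solution is a minimum, so the derivative vanishes there too. The energy
  \<open>u\<^sup>2 + u'\<^sup>2\<close> changes at most at an exponential rate on a compact interval, hence it vanishes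
  to the left of the zero.
\<close>

lemma zero_propagates_left:
  assumes ode: "drift_ode c {A<..<B} u (\<lambda>x. x * u x + u x ^ 3)"
    and nonneg: "\<And>x. A < x \<Longrightarrow> x < B \<Longrightarrow> 0 \<le> u x"
    and z: "A < z" "z < B" "u z = 0" and y: "A < y" "y < z"
  shows "u y = 0"
proof -
  have z': "deriv u z = 0"
    by (rule interior_min_deriv_zero[OF drift_odeD(1)[OF ode] z(1,2)]) (use nonneg z in auto)
  have "continuous_on {y..z} (\<lambda>x. x + (u x)\<^sup>2)"
    by (intro continuous_intros continuous_on_subset[OF drift_ode_continuous_on[OF ode]])
       (use y z in auto)
  then have "bounded ((\<lambda>x. x + (u x)\<^sup>2) ` {y..z})"
    by (intro compact_imp_bounded compact_continuous_image) auto
  then obtain C where C: "\<forall>x\<in>{y..z}. \<bar>x + (u x)\<^sup>2\<bar> \<le> C"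
    unfolding bounded_iff by auto
  define L where "L = 1 + C + 2 * \<bar>c\<bar>"
  define E where "E = (\<lambda>x. ((u x)\<^sup>2 + (deriv u x)\<^sup>2) * exp (L * x))"
  have "E y \<le> E z"
  proof (rule DERIV_nonneg_imp_nondecreasing[where f = E])
    fix x assume x: "y \<le> x" "x \<le> z"
    then have xi: "x \<in> {A<..<B}" using y z by auto
    let ?a = "u x" and ?b = "deriv u x"
    have d: "(E has_real_derivative (2 * ?a * ?b + 2 * ?b * ((x + ?a\<^sup>2) * ?a - c * ?b)
        + L * (?a\<^sup>2 + ?b\<^sup>2)) * exp (L * x)) (at x)"
      unfolding E_def
      by (auto intro!: derivative_eq_intros drift_odeD[OF ode xi]
        simp: algebra_simps power2_eq_square power3_eq_cube)
    have ab: "\<bar>2 * (?a * ?b)\<bar> \<le> ?a\<^sup>2 + ?b\<^sup>2"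
      using sum_squares_bound[of "\<bar>?a\<bar>" "\<bar>?b\<bar>"] by (simp add: abs_mult)
    have "\<bar>(1 + (x + ?a\<^sup>2)) * (2 * (?a * ?b))\<bar> \<le> (1 + C) * (?a\<^sup>2 + ?b\<^sup>2)"
      unfolding abs_mult[of "1 + (x + ?a\<^sup>2)"] using C x ab by (intro mult_mono) (auto dest: bspec[of _ _ x])
    moreover have "\<bar>2 * c * ?b\<^sup>2\<bar> \<le> 2 * \<bar>c\<bar> * (?a\<^sup>2 + ?b\<^sup>2)"
      by (auto simp: abs_mult intro!: mult_left_mono)
    moreover have "2 * ?a * ?b + 2 * ?b * ((x + ?a\<^sup>2) * ?a - c * ?b) =
        (1 + (x + ?a\<^sup>2)) * (2 * (?a * ?b)) - 2 * c * ?b\<^sup>2"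
      by (simp add: algebra_simps power2_eq_square)
    moreover have "L * (?a\<^sup>2 + ?b\<^sup>2) = (1 + C) * (?a\<^sup>2 + ?b\<^sup>2) + 2 * \<bar>c\<bar> * (?a\<^sup>2 + ?b\<^sup>2)"
      unfolding L_def by (simp add: algebra_simps)
    ultimately have "0 \<le> 2 * ?a * ?b + 2 * ?b * ((x + ?a\<^sup>2) * ?a - c * ?b) + L * (?a\<^sup>2 + ?b\<^sup>2)"
      by linarith
    then show "\<exists>l. (E has_real_derivative l) (at x) \<and> 0 \<le> l"
      using d by (meson mult_nonneg_nonneg exp_ge_zero)
  qed (use y in simp)
  also have "E z = 0" unfolding E_def using z z' by simp
  finally have "(u y)\<^sup>2 + (deriv u y)\<^sup>2 \<le> 0" unfolding E_def by (simp add: mult_le_0_iff)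
  then show ?thesis by (smt (verit) zero_le_power2 power2_eq_iff zero_power2 zero_eq_power2)
qed

text \<open>
  A zero would spread to the left end, where the boundary value is positive.
\<close>

lemma nonlinear_dirichlet_positive:
  assumes "A < B" "0 < \<alpha>" "\<alpha> \<le> M" "0 < \<beta>" "\<beta> \<le> M" "0 \<le> A + M\<^sup>2"
  shows "\<exists>u. continuous_on {A..B} u \<and> drift_ode c {A<..<B} u (\<lambda>x. x * u x + u x ^ 3) \<and>
             u A = \<alpha> \<and> u B = \<beta> \<and> (\<forall>x\<in>{A..B}. 0 < u x)"
proof -
  obtain u where u: "continuous_on {A..B} u" "drift_ode c {A<..<B} u (\<lambda>x. x * u x + u x ^ 3)"
      "u A = \<alpha>" "u B = \<beta>" and nn: "\<And>x. x \<in> {A..B} \<Longrightarrow> 0 \<le> u x"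
    using nonlinear_dirichlet_problem[OF assms(1-3) less_imp_le[OF assms(4)] assms(5,6)] by blast
  have "0 < u x" if x: "x \<in> {A..B}" for x
  proof (rule ccontr)
    assume "\<not> 0 < u x"
    then have z: "u x = 0" using nn[OF x] by simp
    then have i: "A < x" "x < B" using x u assms by (auto simp: less_le)
    have "u A = 0"
    proof (rule continuous_constant_on_closure[where S = "{A<..<x}" and f = u])
      show "continuous_on (closure {A<..<x}) u"
        by (rule continuous_on_subset[OF u(1)]) (use i in auto)
      show "u y = 0" if "y \<in> {A<..<x}" for y
        by (rule zero_propagates_left[OF u(2) _ i z]) (use nn that in auto)
      show "A \<in> closure {A<..<x}" using i by simp
    qed
    then show False using u assms by simp
  qed
  then show ?thesis using u by blast
qed

section \<open>Comparison through ratios\<close>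

definition wronskian :: "real \<Rightarrow> (real \<Rightarrow> real) \<Rightarrow> (real \<Rightarrow> real) \<Rightarrow> real \<Rightarrow> real" where
  "wronskian c p q x = exp (c * x) * (deriv p x * q x - p x * deriv q x)"

text \<open>
  The mean value theorem is applied to the right of the last point where \<open>r \<le> m\<close>, so that the
  point found also satisfies \<open>m < r x\<close>.
\<close>

lemma ratio_increase_point:
  fixes r :: "real \<Rightarrow> real"
  assumes "a < b" "continuous_on {a..b} r" "\<And>x. a < x \<Longrightarrow> x < b \<Longrightarrow> r differentiable (at x)"
    and "r a \<le> m" "m < r b"
  shows "\<exists>x l. a < x \<and> x < b \<and> m < r x \<and> (r has_real_derivative l) (at x) \<and> 0 < l"
proof -
  define Z where "Z = {a..b} \<inter> r -` {..m}"
  have "closed Z" unfolding Z_def by (rule continuous_closed_preimage[OF assms(2)]) auto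
  then have "compact Z" unfolding Z_def by (metis compact_Icc compact_Int_closed inf.idem inf_left_idem)
  moreover have "a \<in> Z" unfolding Z_def using assms by auto
  ultimately obtain s where s: "s \<in> Z" "\<And>t. t \<in> Z \<Longrightarrow> t \<le> s"
    using compact_attains_sup[of Z] by auto
  have sb: "a \<le> s" "s < b" "r s \<le> m" using s(1) assms(5) unfolding Z_def by (auto simp: less_le)
  obtain l x where x: "s < x" "x < b" "(r has_real_derivative l) (at x)" "r b - r s = (b - s) * l"
    using MVT[OF sb(2) continuous_on_subset[OF assms(2)]] assms(3) sb by force
  have "0 < (b - s) * l" using x(4) sb assms(5) by simp
  then have "0 < l" using sb by (simp add: zero_less_mult_iff)
  moreover have "m < r x" using s(2)[of x] x sb unfolding Z_def by force
  ultimately show ?thesis using x sb by (intro exI[of _ x] exI[of _ l]) auto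
qed

lemma has_derivative_ratio:
  assumes "drift_ode c S p f" "drift_ode c S q g" "x \<in> S" "0 < q x"
  shows "((\<lambda>x. p x / q x) has_real_derivative wronskian c p q x / (exp (c * x) * (q x)\<^sup>2)) (at x)"
  unfolding wronskian_def using assms(4)
  by (auto intro!: derivative_eq_intros drift_odeD(1)[OF assms(1,3)] drift_odeD(1)[OF assms(2,3)]
      simp: power2_eq_square)

lemma has_derivative_wronskian:
  assumes "drift_ode c S p f" "drift_ode c S q g" "x \<in> S"
  shows "(wronskian c p q has_real_derivative exp (c * x) * (f x * q x - p x * g x)) (at x)"
  unfolding wronskian_def[abs_def]
  by (auto intro!: derivative_eq_intros drift_odeD[OF assms(1,3)] drift_odeD[OF assms(2,3)]
      simp: algebra_simps)

text \<open>
  The differential inequalities are demanded only where \<open>q < p\<close>. There \<open>p\<close> is positive, so a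
  subsolution may be used without regard to the region where it is negative.
\<close>

locale sub_super_pair =
  fixes c :: real and S :: "real set" and p f q g :: "real \<Rightarrow> real"
  assumes sub_ode: "drift_ode c S p f" and super_ode: "drift_ode c S q g"
    and super_pos: "x \<in> S \<Longrightarrow> 0 < q x"
    and sub_le: "x \<in> S \<Longrightarrow> q x < p x \<Longrightarrow> x * p x + p x ^ 3 \<le> f x"
    and super_ge: "x \<in> S \<Longrightarrow> q x < p x \<Longrightarrow> g x \<le> x * q x + q x ^ 3"
begin

lemma wronskian_mono:
  assumes "s \<le> t" "{s..t} \<subseteq> S" "\<And>x. s \<le> x \<Longrightarrow> x \<le> t \<Longrightarrow> q x < p x"
  shows "wronskian c p q s \<le> wronskian c p q t"
proof (rule DERIV_nonneg_imp_nondecreasing[OF assms(1)])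
  fix x assume x: "s \<le> x" "x \<le> t"
  then have xS: "x \<in> S" using assms by auto
  note q = super_pos[OF xS] and pq = assms(3)[OF x]
  have "0 \<le> p x * q x * ((p x)\<^sup>2 - (q x)\<^sup>2)"
    using q pq by (intro mult_nonneg_nonneg) (auto intro!: power_mono)
  also have "\<dots> = (x * p x + p x ^ 3) * q x - p x * (x * q x + q x ^ 3)"
    by (simp add: algebra_simps power2_eq_square power3_eq_cube)
  also have "\<dots> \<le> f x * q x - p x * g x"
    using sub_le[OF xS pq] super_ge[OF xS pq] q pq
    by (intro diff_mono mult_right_mono mult_left_mono) auto
  finally show "\<exists>l. (wronskian c p q has_real_derivative l) (at x) \<and> 0 \<le> l"
    using has_derivative_wronskian[OF sub_ode super_ode xS] by (intro exI conjI) auto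
qed

text \<open>
  Up to the first point where the ratio returns to 1, the Wronskian stays at least as large as at
  \<open>s\<close> and so the ratio increases: it cannot return.
\<close>

lemma dominance_propagates:
  assumes "s \<le> t" "{s..<t} \<subseteq> S" "continuous_on {s..t} (\<lambda>x. p x / q x)" "0 < q t"
    and start: "q s < p s" "0 < wronskian c p q s"
  shows "q t < p t"
proof (rule ccontr)
  assume "\<not> q t < p t"
  then have t: "p t / q t \<le> 1" "s < t" using assms by (auto simp: less_le)
  define Z where "Z = {s..t} \<inter> (\<lambda>x. p x / q x) -` {..1}"
  have "closed Z" unfolding Z_def by (rule continuous_closed_preimage[OF assms(3)]) auto
  then have "compact Z" unfolding Z_def by (metis compact_Icc compact_Int_closed inf.idem inf_left_idem)
  moreover have "t \<in> Z" unfolding Z_def using t by auto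
  ultimately obtain y where y: "y \<in> Z" "\<And>x. x \<in> Z \<Longrightarrow> y \<le> x"
    using compact_attains_inf[of Z] by auto
  have sS: "s \<in> S" using assms t by auto
  have "s \<noteq> y" using y(1) start super_pos[OF sS] unfolding Z_def by auto
  then have sy: "s < y" "y \<le> t" "p y / q y \<le> 1" using y(1) unfolding Z_def by auto
  have pq: "q x < p x" if "s \<le> x" "x < y" for x
  proof -
    have "x \<notin> Z" using y(2)[of x] that by auto
    moreover have "0 < q x" using assms(2) that sy by (intro super_pos) auto
    ultimately show ?thesis unfolding Z_def using that sy by (auto simp: field_simps)
  qed
  have "p s / q s < p y / q y"
  proof (rule DERIV_pos_imp_increasing_open[OF sy(1)])
    fix x assume x: "s < x" "x < y"
    then have xS: "x \<in> S" using assms(2) sy by auto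
    have "wronskian c p q s \<le> wronskian c p q x"
      using x sy pq assms(2) by (intro wronskian_mono) auto
    then have "0 < wronskian c p q x / (exp (c * x) * (q x)\<^sup>2)"
      using super_pos[OF xS] start by (intro divide_pos_pos mult_pos_pos) auto
    then show "\<exists>l. ((\<lambda>x. p x / q x) has_real_derivative l) (at x) \<and> 0 < l"
      using has_derivative_ratio[OF sub_ode super_ode xS super_pos[OF xS]] by blast
  qed (rule continuous_on_subset[OF assms(3)], use sy in auto)
  moreover have "1 < p s / q s" using start super_pos[OF sS] by simp
  ultimately show False using sy by simp
qed

end

lemma comparison_bounded_interval:
  assumes pair: "sub_super_pair c {A<..<B} p f q g"
    and cont: "continuous_on {A..B} p" "continuous_on {A..B} q"
    and q: "0 < q A" "0 < q B" and bdry: "p A \<le> q A" "p B \<le> q B" and x: "x \<in> {A..B}"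
  shows "p x \<le> q x"
proof (rule ccontr)
  interpret sub_super_pair c "{A<..<B}" p f q g by (rule pair)
  assume "\<not> p x \<le> q x"
  then have x: "A < x" "x < B" "q x < p x" using x bdry by (auto simp: less_le)
  have qpos: "0 < q y" if "y \<in> {A..B}" for y
    using that q super_pos[of y] by (cases "y = A \<or> y = B") auto
  have rc: "continuous_on {A..B} (\<lambda>x. p x / q x)"
    using qpos by (intro continuous_intros cont) (auto simp: less_imp_neq[symmetric] dest: qpos)
  have dr: "((\<lambda>x. p x / q x) has_real_derivative wronskian c p q y / (exp (c * y) * (q y)\<^sup>2)) (at y)"
    if "A < y" "y < B" for y
    using that qpos[of y] by (intro has_derivative_ratio[OF sub_ode super_ode]) auto
  have "\<exists>y l. A < y \<and> y < x \<and> 1 < p y / q y \<and> ((\<lambda>x. p x / q x) has_real_derivative l) (at y) \<and> 0 < l"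
  proof (rule ratio_increase_point)
    show "(\<lambda>x. p x / q x) differentiable (at y)" if "A < y" "y < x" for y
      using dr[of y] that x real_differentiable_def by auto
  qed (use x bdry q qpos[of x] in \<open>auto intro: continuous_on_subset[OF rc]\<close>)
  then obtain y l where y: "A < y" "y < x" "1 < p y / q y"
      "((\<lambda>x. p x / q x) has_real_derivative l) (at y)" "0 < l" by blast
  have "0 < wronskian c p q y / (exp (c * y) * (q y)\<^sup>2)"
    using DERIV_unique[OF y(4) dr] y x by auto
  moreover have "0 < exp (c * y) * (q y)\<^sup>2" using qpos[of y] y x by simp
  ultimately have "0 < wronskian c p q y" by (metis zero_less_divide_iff order.asym)
  moreover have "q y < p y" using y qpos[of y] x by auto
  ultimately have "q B < p B"
    using y x q by (intro dominance_propagates[of y B] continuous_on_subset[OF rc]) auto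
  then show False using bdry by simp
qed

text \<open>
  On the right half-line both \<open>exp (c x) p'\<close> and the flux \<open>p' + c p\<close> are nondecreasing. If either
  became positive, \<open>p\<close> could not tend to 0. A nonpositive flux says that \<open>exp (c x) p\<close>
  decreases.
\<close>

lemma decaying_subsolution:
  assumes ode: "drift_ode c UNIV p f" and f: "\<And>x. 0 \<le> x \<Longrightarrow> 0 \<le> f x"
    and pos: "\<And>x. 0 < p x" and lim: "(p \<longlongrightarrow> 0) at_top" and x: "0 \<le> x"
  shows "deriv p x \<le> 0" and "exp (c * x) * p x \<le> p 0"
proof -
  note D = drift_odeD[OF ode UNIV_I]
  have p': "deriv p x \<le> 0" if "0 \<le> x" for x
  proof (rule ccontr)
    assume neg: "\<not> deriv p x \<le> 0"
    have incr: "exp (c * x) * deriv p x \<le> exp (c * y) * deriv p y" if "x \<le> y" for y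
    proof (rule DERIV_nonneg_imp_nondecreasing[OF that])
      fix z assume "x \<le> z" "z \<le> y"
      then have "0 \<le> exp (c * z) * f z" using f[of z] \<open>0 \<le> x\<close> by simp
      moreover have "((\<lambda>x. exp (c * x) * deriv p x) has_real_derivative exp (c * z) * f z) (at z)"
        by (auto intro!: derivative_eq_intros D simp: algebra_simps)
      ultimately show "\<exists>l. ((\<lambda>x. exp (c * x) * deriv p x) has_real_derivative l) (at z) \<and> 0 \<le> l"
        by blast
    qed
    have p'pos: "0 < deriv p y" if "x \<le> y" for y
    proof -
      have "0 < exp (c * x) * deriv p x" using neg by simp
      then have "0 < exp (c * y) * deriv p y" using incr[OF that] by linarith
      then show ?thesis by (simp add: zero_less_mult_iff)
    qed
    have "p x \<le> p y" if "x \<le> y" for y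
      by (rule DERIV_nonneg_imp_nondecreasing[OF that]) (use D(1) p'pos less_imp_le in blast)
    then have "p x \<le> 0"
      by (intro tendsto_lowerbound[OF lim] eventually_at_top_linorderI[of x]) auto
    then show False using pos[of x] by simp
  qed
  then show "deriv p x \<le> 0" using x by blast
  have flux: "deriv p x + c * p x \<le> 0" if "0 \<le> x" for x
  proof -
    \<comment> \<open>The term \<open>deriv p y\<close> can be dropped, being nonpositive; the right side then tends to 0.\<close>
    have "deriv p x + c * p x \<le> c * p y" if "x \<le> y" for y
    proof -
      have "deriv p x + c * p x \<le> deriv p y + c * p y"
      proof (rule DERIV_nonneg_imp_nondecreasing[OF that])
        fix z assume "x \<le> z" "z \<le> y"
        moreover have "((\<lambda>x. deriv p x + c * p x) has_real_derivative f z) (at z)"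
          by (auto intro!: derivative_eq_intros D)
        ultimately show "\<exists>l. ((\<lambda>x. deriv p x + c * p x) has_real_derivative l) (at z) \<and> 0 \<le> l"
          using f[of z] \<open>0 \<le> x\<close> by (intro exI conjI) auto
      qed
      then show ?thesis using p'[of y] that \<open>0 \<le> x\<close> by linarith
    qed
    then have "\<forall>\<^sub>F y in at_top. deriv p x + c * p x \<le> c * p y"
      by (rule eventually_at_top_linorderI)
    moreover have "((\<lambda>y. c * p y) \<longlongrightarrow> c * 0) at_top" by (intro tendsto_intros lim)
    ultimately have "deriv p x + c * p x \<le> c * 0"
      by (intro tendsto_lowerbound[where f = "\<lambda>y. c * p y" and F = at_top]) auto
    then show ?thesis by simp
  qed
  have "exp (c * x) * p x \<le> exp (c * 0) * p 0"
  proof (rule DERIV_nonpos_imp_nonincreasing[OF x])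
    fix z assume "0 \<le> z" "z \<le> x"
    then have "exp (c * z) * (deriv p z + c * p z) \<le> 0" using flux[of z] by (simp add: mult_le_0_iff)
    moreover have "((\<lambda>x. exp (c * x) * p x) has_real_derivative exp (c * z) * (deriv p z + c * p z)) (at z)"
      by (auto intro!: derivative_eq_intros D simp: algebra_simps)
    ultimately show "\<exists>l. ((\<lambda>x. exp (c * x) * p x) has_real_derivative l) (at z) \<and> l \<le> 0"
      by blast
  qed
  then show "exp (c * x) * p x \<le> p 0" by simp
qed

text \<open>
  If \<open>p > q\<close> somewhere, then \<open>p / q \<rightarrow> 1\<close> on the left provides a point where the ratio
  exceeds 1 and increases. From there on \<open>W\<close> is bounded below by a positive number, and since
  \<open>exp (c x) p \<le> p 0\<close> and \<open>p' \<le> 0\<close>, this number bounds \<open>- p 0 * q'\<close> from below.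
\<close>

lemma comparison_real_line:
  assumes p: "drift_ode c UNIV p f" "\<And>x. 0 < p x" "\<And>x. x * p x + p x ^ 3 \<le> f x"
    and q: "drift_ode c UNIV q g" "\<And>x. 0 < q x" "\<And>x. g x \<le> x * q x + q x ^ 3"
    and left: "((\<lambda>x. p x / q x) \<longlongrightarrow> 1) at_bot" and right: "(p \<longlongrightarrow> 0) at_top"
  shows "p x \<le> q x"
proof (rule ccontr)
  interpret sub_super_pair c UNIV p f q g by unfold_locales (use p q in auto)
  assume "\<not> p x \<le> q x"
  then have x: "1 < p x / q x" using q(2)[of x] by simp
  have dr: "((\<lambda>x. p x / q x) has_real_derivative wronskian c p q y / (exp (c * y) * (q y)\<^sup>2)) (at y)" for y
    by (intro has_derivative_ratio[OF sub_ode super_ode]) (auto simp: q)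
  have rc: "continuous_on S (\<lambda>x. p x / q x)" for S
    using dr by (meson DERIV_isCont continuous_at_imp_continuous_on)
  have "eventually (\<lambda>y. p y / q y < p x / q x) at_bot"
    using order_tendstoD(2)[OF left x] .
  then obtain N where N: "\<And>y. y \<le> N \<Longrightarrow> p y / q y < p x / q x"
    unfolding eventually_at_bot_linorder by auto
  define a where "a = min N (x - 1)"
  have a: "a < x" "p a / q a < p x / q x" using N[of a] unfolding a_def by auto
  have "\<exists>y l. a < y \<and> y < x \<and> max 1 (p a / q a) < p y / q y \<and>
      ((\<lambda>x. p x / q x) has_real_derivative l) (at y) \<and> 0 < l"
    by (rule ratio_increase_point[OF a(1) rc]) (use dr a x real_differentiable_def in auto)
  then obtain y l where y: "1 < p y / q y" "((\<lambda>x. p x / q x) has_real_derivative l) (at y)" "0 < l"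
    by auto
  have "0 < wronskian c p q y / (exp (c * y) * (q y)\<^sup>2)"
    using DERIV_unique[OF y(2) dr] y by auto
  moreover have "0 < exp (c * y) * (q y)\<^sup>2" using q(2)[of y] by simp
  ultimately have W: "0 < wronskian c p q y" by (metis zero_less_divide_iff order.asym)
  have "q y < p y" using y q(2)[of y] by simp
  then have dom: "q t < p t" if "y \<le> t" for t
    using that W by (intro dominance_propagates[of y t] rc) (auto simp: q)
  define \<delta> where "\<delta> = wronskian c p q y / p 0"
  have \<delta>: "\<delta> > 0" unfolding \<delta>_def using W p(2)[of 0] by simp
  define X where "X = max y 0"
  have slope: "deriv q t \<le> - \<delta>" if "X \<le> t" for t
  proof -
    have t: "0 \<le> t" "y \<le> t" using that unfolding X_def by auto
    have f0: "0 \<le> f s" if "0 \<le> s" for s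
      using p(3)[of s] p(2)[of s] that
      by (meson add_nonneg_nonneg less_imp_le mult_nonneg_nonneg order_trans zero_le_power)
    note dec = decaying_subsolution[OF p(1) f0 p(2) right t(1)]
    have "wronskian c p q y \<le> wronskian c p q t"
      by (rule wronskian_mono) (use t dom in auto)
    also have "\<dots> = exp (c * t) * (deriv p t * q t) + exp (c * t) * p t * (- deriv q t)"
      unfolding wronskian_def by (simp add: algebra_simps)
    also have "exp (c * t) * (deriv p t * q t) \<le> 0"
      using dec(1) q(2)[of t] by (simp add: mult_le_0_iff)
    finally have *: "wronskian c p q y \<le> exp (c * t) * p t * (- deriv q t)" by simp
    then have "0 < exp (c * t) * p t * (- deriv q t)" using W by linarith
    moreover have "0 < exp (c * t) * p t" using p(2)[of t] by simp
    ultimately have "0 \<le> - deriv q t" by (metis zero_less_mult_iff order.asym less_imp_le)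
    then have "exp (c * t) * p t * (- deriv q t) \<le> p 0 * (- deriv q t)"
      by (intro mult_right_mono dec(2))
    with * have "wronskian c p q y \<le> p 0 * (- deriv q t)" by linarith
    then show ?thesis unfolding \<delta>_def using p(2)[of 0] by (simp add: field_simps)
  qed
  \<comment> \<open>The line through \<open>(X, q X)\<close> with slope \<open>- \<delta>\<close> reaches 0 at \<open>T\<close>.\<close>
  define T where "T = X + q X / \<delta>"
  have "X \<le> T" unfolding T_def using \<delta> q(2)[of X] by simp
  have "q T + \<delta> * T \<le> q X + \<delta> * X"
  proof (rule DERIV_nonpos_imp_nonincreasing[OF \<open>X \<le> T\<close>, where f = "\<lambda>x. q x + \<delta> * x"])
    fix t assume "X \<le> t" "t \<le> T"
    moreover have "((\<lambda>x. q x + \<delta> * x) has_real_derivative deriv q t + \<delta>) (at t)"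
      by (auto intro!: derivative_eq_intros drift_odeD(1)[OF q(1)])
    ultimately show "\<exists>l. ((\<lambda>x. q x + \<delta> * x) has_real_derivative l) (at t) \<and> l \<le> 0"
      using slope[of t] by (intro exI conjI) auto
  qed
  also have "\<dots> = \<delta> * T" unfolding T_def using \<delta> by (simp add: field_simps)
  finally show False using q(2)[of T] by simp
qed

section \<open>Explicit sub- and supersolutions\<close>

text \<open>
  For \<open>r = sqrt h\<close> and \<open>h' = - \<sigma>\<close> with the logistic function \<open>\<sigma>\<close>, apart from a
  negative term \<open>2 r (r'' + c r')\<close> is \<open>\<sigma> (1 - \<sigma>) - c \<sigma> \<le> (1 + \<bar>c\<bar>) \<sigma>\<close>. Since \<open>\<sigma> \<le> h\<close>, this is at
  most \<open>2 a h\<close> with \<open>a = (1 + \<bar>c\<bar>) / 2\<close>, while \<open>2 r (x r + r\<^sup>3) = 2 h (x + h) \<ge> 2 a h\<close>. This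
  fixes the shift \<open>a\<close>.
\<close>

lemma supersolution:
  fixes c :: real
  defines "h \<equiv> \<lambda>x. ln (1 + exp ((1 + \<bar>c\<bar>) / 2 - x))"
  shows "\<exists>g. drift_ode c UNIV (\<lambda>x. sqrt (h x)) g \<and> (\<forall>x. g x \<le> x * sqrt (h x) + sqrt (h x) ^ 3)"
proof -
  define a where "a = (1 + \<bar>c\<bar>) / 2"
  define e where "e = (\<lambda>x. exp (a - x))"
  define \<sigma> where "\<sigma> = (\<lambda>x. e x / (1 + e x))"
  have e: "e x > 0" for x unfolding e_def by simp
  have h: "h x = ln (1 + e x)" for x unfolding h_def e_def a_def by simp
  have \<sigma>: "0 < \<sigma> x" "\<sigma> x < 1" for x unfolding \<sigma>_def using e[of x] by auto
  have hpos: "0 < h x" for x unfolding h using e[of x] by simp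
  have h\<sigma>: "\<sigma> x \<le> h x" for x
  proof -
    have "ln (inverse (1 + e x)) \<le> inverse (1 + e x) - 1"
      using e[of x] by (intro ln_le_minus_one) simp
    moreover have "ln (inverse (1 + e x)) = - ln (1 + e x)"
      by (rule ln_inverse)
    moreover have "\<sigma> x = 1 - inverse (1 + e x)" unfolding \<sigma>_def using e[of x] by (simp add: field_simps)
    ultimately show ?thesis unfolding h by simp
  qed
  have hx: "a - x \<le> h x" for x
  proof -
    have "ln (e x) \<le> ln (1 + e x)" using e[of x] by simp
    then show ?thesis unfolding h by (simp add: e_def)
  qed
  have e': "(e has_real_derivative - e x) (at x)" for x
    unfolding e_def by (auto intro!: derivative_eq_intros)
  have h': "(h has_real_derivative - \<sigma> x) (at x)" for x
    unfolding h[abs_def] \<sigma>_def using e[of x]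
    by (auto intro!: derivative_eq_intros e' simp: divide_inverse add_pos_pos)
  have \<sigma>': "(\<sigma> has_real_derivative - (\<sigma> x * (1 - \<sigma> x))) (at x)" for x
  proof -
    have "1 + e x \<noteq> 0" using e[of x] by simp
    then show ?thesis
      unfolding \<sigma>_def by (auto intro!: derivative_eq_intros e' simp: field_simps)
  qed
  define r where "r = (\<lambda>x. sqrt (h x))"
  have r: "0 < r x" "(r x)\<^sup>2 = h x" for x unfolding r_def using hpos[of x] by auto
  have r': "(r has_real_derivative - \<sigma> x / (2 * r x)) (at x)" for x
    unfolding r_def using hpos[of x] by (auto intro!: derivative_eq_intros h' simp: field_simps)
  have r3: "r x ^ 3 = h x * r x" for x
    using r(2)[of x] by (simp add: power3_eq_cube power2_eq_square)
  define g where "g = (\<lambda>x. \<sigma> x * (1 - \<sigma> x) / (2 * r x) - (\<sigma> x)\<^sup>2 / (4 * r x ^ 3) - c * \<sigma> x / (2 * r x))"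
  have "drift_ode c UNIV r g"
  proof (rule drift_odeI[where u' = "\<lambda>x. - \<sigma> x / (2 * r x)"])
    fix x
    show "(r has_real_derivative - \<sigma> x / (2 * r x)) (at x)" by (rule r')
    show "((\<lambda>x. - \<sigma> x / (2 * r x)) has_real_derivative g x - c * (- \<sigma> x / (2 * r x))) (at x)"
      unfolding g_def using r(1)[of x]
      by (auto intro!: derivative_eq_intros \<sigma>' r' simp: field_simps power2_eq_square power3_eq_cube)
  qed simp
  moreover have "g x \<le> x * r x + r x ^ 3" for x
  proof -
    have "\<sigma> x * (1 - \<sigma> x) - c * \<sigma> x \<le> 2 * a * \<sigma> x"
    proof -
      have "- c * \<sigma> x \<le> \<bar>c\<bar> * \<sigma> x" using \<sigma>[of x] by (intro mult_right_mono) auto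
      moreover have "\<sigma> x * (1 - \<sigma> x) \<le> \<sigma> x * 1" using \<sigma>[of x] by (intro mult_left_mono) auto
      moreover have "2 * a * \<sigma> x = \<sigma> x + \<bar>c\<bar> * \<sigma> x" unfolding a_def by (simp add: distrib_right)
      ultimately show ?thesis by linarith
    qed
    also have "\<dots> \<le> 2 * a * h x" using h\<sigma>[of x] unfolding a_def by (intro mult_left_mono) auto
    finally have "(\<sigma> x * (1 - \<sigma> x) - c * \<sigma> x) / (2 * r x) \<le> 2 * a * h x / (2 * r x)"
      using r(1)[of x] by (intro divide_right_mono) auto
    also have "2 * a * h x / (2 * r x) = a * r x"
      unfolding r(2)[of x, symmetric] using r(1)[of x] by (simp add: power2_eq_square)
    finally have "g x \<le> a * r x"
      unfolding g_def diff_divide_distrib using r(1)[of x]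
      by (smt (verit) divide_nonneg_pos zero_le_power2 zero_less_power)
    also have "\<dots> \<le> (x + h x) * r x" using hx[of x] r(1)[of x] by (intro mult_right_mono) auto
    finally show ?thesis unfolding r3 by (simp add: algebra_simps)
  qed
  ultimately show ?thesis unfolding r_def by blast
qed

text \<open>
  For \<open>r = sqrt (- b - x)\<close> one has \<open>x r + r\<^sup>3 = - b r\<close> exactly, and the derivative terms
  \<open>- 1 / (4 r\<^sup>3) - c / (2 r)\<close> are controlled by \<open>b r\<close> once \<open>r \<ge> 1\<close>.
\<close>

lemma sqrt_subsolution:
  fixes b c :: real
  assumes b: "\<bar>c\<bar> / 2 + 1 / 4 \<le> b"
  shows "\<exists>f. drift_ode c {..< - b} (\<lambda>x. sqrt (- b - x)) f \<and>
             (\<forall>x\<le>- b - 1. x * sqrt (- b - x) + sqrt (- b - x) ^ 3 \<le> f x)"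
proof -
  define r where "r = (\<lambda>x. sqrt (- b - x))"
  define f where "f = (\<lambda>x. - 1 / (4 * r x ^ 3) - c / (2 * r x))"
  have r: "0 < r x" "(r x)\<^sup>2 = - b - x" if "x < - b" for x
    unfolding r_def using that by auto
  have r': "(r has_real_derivative - 1 / (2 * r x)) (at x)" if "x < - b" for x
    unfolding r_def using that by (auto intro!: derivative_eq_intros simp: field_simps)
  have "drift_ode c {..< - b} r f"
  proof (rule drift_odeI[where u' = "\<lambda>x. - 1 / (2 * r x)"])
    fix x assume "x \<in> {..< - b}"
    then have x: "x < - b" by simp
    show "(r has_real_derivative - 1 / (2 * r x)) (at x)" by (rule r'[OF x])
    show "((\<lambda>x. - 1 / (2 * r x)) has_real_derivative f x - c * (- 1 / (2 * r x))) (at x)"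
      unfolding f_def using r(1)[OF x]
      by (auto intro!: derivative_eq_intros r'[OF x] simp: field_simps power2_eq_square power3_eq_cube)
  qed simp
  moreover have "x * r x + r x ^ 3 \<le> f x" if "x \<le> - b - 1" for x
  proof -
    have "x < - b" using that by simp
    note rx = r[OF this]
    define t where "t = (r x)\<^sup>2"
    have t: "1 \<le> t" using rx(2) that t_def by simp
    have "0 \<le> 4 * b" using b by linarith
    have "1 + 2 * c * t \<le> t + 2 * \<bar>c\<bar> * t"
      using t by (intro add_mono mult_right_mono) auto
    also have "\<dots> = (1 + 2 * \<bar>c\<bar>) * t" by (simp add: algebra_simps)
    also have "\<dots> \<le> (4 * b) * t" using t b by (intro mult_right_mono) auto
    also have "\<dots> \<le> 4 * b * (t * t)" using t \<open>0 \<le> 4 * b\<close> by (intro mult_left_mono) auto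
    finally have "1 + 2 * c * t \<le> 4 * b * (t * t)" .
    then have "(1 + 2 * c * t) / (4 * r x ^ 3) \<le> 4 * b * (t * t) / (4 * r x ^ 3)"
      using rx(1) by (intro divide_right_mono) auto
    also have "4 * b * (t * t) / (4 * r x ^ 3) = b * r x"
      using rx(1) by (simp add: t_def power2_eq_square power3_eq_cube)
    also have "(1 + 2 * c * t) / (4 * r x ^ 3) = - f x"
      unfolding f_def t_def using rx(1) by (simp add: field_simps power2_eq_square power3_eq_cube)
    finally have "- (b * r x) \<le> f x" by simp
    moreover have "x * r x + r x ^ 3 = - (b * r x)"
    proof -
      have "x * r x + r x ^ 3 = (x + (r x)\<^sup>2) * r x"
        by (simp add: algebra_simps power2_eq_square power3_eq_cube)
      then show ?thesis unfolding rx(2) by simp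
    qed
    ultimately show ?thesis by simp
  qed
  ultimately show ?thesis unfolding r_def by blast
qed

text \<open>
  The bump solves \<open>p'' + c p' = - (1 + c\<^sup>2 / 4) p\<close>. On its arch \<open>\<bar>x + L\<bar> \<le> pi / 2 < 2\<close>
  one has \<open>p\<^sup>2 \<le> exp (2 \<bar>c\<bar>)\<close>, so the stated size of \<open>L\<close> is what makes
  \<open>x + p\<^sup>2 \<le> - (1 + c\<^sup>2 / 4)\<close>.
\<close>

lemma bump_subsolution:
  fixes c L :: real
  assumes L: "3 + c\<^sup>2 / 4 + exp (2 * \<bar>c\<bar>) \<le> L"
  defines "p \<equiv> \<lambda>x. exp (- c * (x + L) / 2) * cos (x + L)"
  shows "\<exists>f. drift_ode c UNIV p f \<and> (\<forall>x. \<bar>x + L\<bar> \<le> pi / 2 \<longrightarrow> x * p x + p x ^ 3 \<le> f x)"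
proof -
  define f where "f = (\<lambda>x. - (1 + c\<^sup>2 / 4) * p x)"
  define E where "E = (\<lambda>x. exp (- c * (x + L) / 2))"
  have p: "p = (\<lambda>x. E x * cos (x + L))" unfolding p_def E_def ..
  have E': "(E has_real_derivative - c / 2 * E x) (at x)" for x
    unfolding E_def by (auto intro!: derivative_eq_intros)
  have "drift_ode c UNIV p f"
  proof (rule drift_odeI[where u' = "\<lambda>x. - E x * (c / 2 * cos (x + L) + sin (x + L))"])
    fix x
    show "(p has_real_derivative - E x * (c / 2 * cos (x + L) + sin (x + L))) (at x)"
      unfolding p by (auto intro!: derivative_eq_intros E' simp: algebra_simps)
    show "((\<lambda>x. - E x * (c / 2 * cos (x + L) + sin (x + L))) has_real_derivative
        f x - c * (- E x * (c / 2 * cos (x + L) + sin (x + L)))) (at x)"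
      unfolding f_def p by (auto intro!: derivative_eq_intros E' simp: field_simps power2_eq_square)
  qed simp
  moreover have "x * p x + p x ^ 3 \<le> f x" if x: "\<bar>x + L\<bar> \<le> pi / 2" for x
  proof -
    have c0: "0 \<le> cos (x + L)" using x by (intro cos_ge_zero; linarith)
    then have p0: "0 \<le> p x" unfolding p_def by simp
    have y: "\<bar>x + L\<bar> \<le> 2" using x pi_less_4 by simp
    have "\<bar>- c * (x + L) / 2\<bar> = \<bar>c\<bar> * \<bar>x + L\<bar> / 2" by (simp add: abs_mult)
    also have "\<dots> \<le> \<bar>c\<bar> * 2 / 2" using y by (intro divide_right_mono mult_left_mono) auto
    finally have "exp (- c * (x + L) / 2) \<le> exp \<bar>c\<bar>" by simp
    then have "p x \<le> exp \<bar>c\<bar> * 1" unfolding p_def using c0 by (intro mult_mono) auto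
    then have "(p x)\<^sup>2 \<le> (exp \<bar>c\<bar>)\<^sup>2" using p0 by (intro power_mono) auto
    also have "\<dots> = exp (2 * \<bar>c\<bar>)" by (simp add: exp_double)
    finally have "x + (p x)\<^sup>2 \<le> - (1 + c\<^sup>2 / 4)" using L y by linarith
    then have "(x + (p x)\<^sup>2) * p x \<le> - (1 + c\<^sup>2 / 4) * p x" using p0 by (rule mult_right_mono)
    then show ?thesis unfolding f_def by (simp add: algebra_simps power2_eq_square power3_eq_cube)
  qed
  ultimately show ?thesis by blast
qed

section \<open>Existence on the real line\<close>

text \<open>
  The solutions \<open>u n\<close> of the Dirichlet problems on \<open>[- N n, N n]\<close> with boundary values \<open>\<psi>\<close> lie
  below \<open>\<psi>\<close>; in particular \<open>u (n + 1) \<le> \<psi> = u n\<close> at the ends of the smaller interval, which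
  makes the sequence decreasing. The bump \<open>\<eta>\<close> and the root \<open>\<phi> = sqrt (- b - x)\<close> bound all
  \<open>u n\<close> from below by the same function.
\<close>

lemma exists_positive_solution:
  "\<exists>v. drift_ode c UNIV v (\<lambda>x. x * v x + v x ^ 3) \<and> (\<forall>x. 0 < v x) \<and>
       ((\<lambda>x. v x - sqrt (- x)) \<longlongrightarrow> 0) at_bot \<and> (v \<longlongrightarrow> 0) at_top"
proof -
  define h where "h = (\<lambda>x. ln (1 + exp ((1 + \<bar>c\<bar>) / 2 - x)))"
  define \<psi> where "\<psi> = (\<lambda>x. sqrt (h x))"
  obtain g where \<psi>ode: "drift_ode c UNIV \<psi> g" and \<psi>super: "\<And>x. g x \<le> x * \<psi> x + \<psi> x ^ 3"
    using supersolution[of c] unfolding \<psi>_def h_def by blast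
  have hpos: "0 < h x" for x unfolding h_def by (simp add: add_pos_pos)
  have hlow: "- x \<le> h x" for x
  proof -
    have "ln (exp (- x)) \<le> ln (1 + exp ((1 + \<bar>c\<bar>) / 2 - x))"
      by (subst ln_le_cancel_iff) (auto simp: add_pos_pos intro!: add_increasing)
    then show ?thesis unfolding h_def by simp
  qed
  have \<psi>pos: "0 < \<psi> x" for x unfolding \<psi>_def using hpos by simp
  have \<psi>sq: "(\<psi> x)\<^sup>2 = h x" for x unfolding \<psi>_def using hpos[of x] by simp
  have \<psi>anti: "\<psi> y \<le> \<psi> x" if "x \<le> y" for x y
    unfolding \<psi>_def h_def using that by (simp add: add_pos_pos)
  have \<psi>cont: "continuous_on S \<psi>" for S
    using drift_ode_continuous_on[OF \<psi>ode] continuous_on_subset by blast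
  define b where "b = 2 + c\<^sup>2 / 4 + exp (2 * \<bar>c\<bar>)"
  define L where "L = b + 1"
  have b: "\<bar>c\<bar> / 2 + 1 / 4 \<le> b"
  proof -
    have "0 \<le> (\<bar>c\<bar> / 2 - 1 / 2)\<^sup>2" by simp
    then have "\<bar>c\<bar> / 2 \<le> c\<^sup>2 / 4 + 1 / 4" by (simp add: power2_eq_square field_simps)
    moreover have "0 \<le> exp (2 * \<bar>c\<bar>)" by simp
    ultimately show ?thesis unfolding b_def by linarith
  qed
  have "0 < b" using b abs_ge_zero[of c] by linarith
  then have "0 < L" unfolding L_def by simp
  obtain f1 where \<phi>ode: "drift_ode c {..< - b} (\<lambda>x. sqrt (- b - x)) f1"
    and \<phi>sub: "\<And>x. x \<le> - b - 1 \<Longrightarrow> x * sqrt (- b - x) + sqrt (- b - x) ^ 3 \<le> f1 x"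
    using sqrt_subsolution[OF b] by blast
  define \<eta> where "\<eta> = (\<lambda>x. exp (- c * (x + L) / 2) * cos (x + L))"
  obtain f2 where \<eta>ode: "drift_ode c UNIV \<eta> f2"
    and \<eta>sub: "\<And>x. \<bar>x + L\<bar> \<le> pi / 2 \<Longrightarrow> x * \<eta> x + \<eta> x ^ 3 \<le> f2 x"
    using bump_subsolution[of c L] unfolding \<eta>_def L_def b_def by auto
  define N where "N = (\<lambda>n::nat. real n + L + 2)"
  have N: "0 < N n" "L + pi / 2 < N n" "N n < N (Suc n)" for n
    unfolding N_def using \<open>0 < L\<close> pi_less_4 by auto
  have Nmono: "N m \<le> N n" if "m \<le> n" for m n unfolding N_def using that by simp
  have ex: "\<exists>u. continuous_on {- N n..N n} u \<and> drift_ode c {- N n<..<N n} u (\<lambda>x. x * u x + u x ^ 3) \<and>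
      u (- N n) = \<psi> (- N n) \<and> u (N n) = \<psi> (N n) \<and> (\<forall>x\<in>{- N n..N n}. 0 < u x)" for n
  proof (rule nonlinear_dirichlet_positive[where M = "\<psi> (- N n)"])
    show "\<psi> (N n) \<le> \<psi> (- N n)" using N(1)[of n] by (intro \<psi>anti) simp
    show "0 \<le> - N n + (\<psi> (- N n))\<^sup>2" unfolding \<psi>sq using hlow[of "- N n"] by simp
  qed (use N(1)[of n] \<psi>pos in auto)
  obtain u where u: "\<forall>n. continuous_on {- N n..N n} (u n) \<and>
      drift_ode c {- N n<..<N n} (u n) (\<lambda>x. x * u n x + u n x ^ 3) \<and>
      u n (- N n) = \<psi> (- N n) \<and> u n (N n) = \<psi> (N n) \<and> (\<forall>x\<in>{- N n..N n}. 0 < u n x)"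
    using choice[OF allI[OF ex]] by (rule exE)
  have uc: "continuous_on {- N n..N n} (u n)"
    and uode: "drift_ode c {- N n<..<N n} (u n) (\<lambda>x. x * u n x + u n x ^ 3)"
    and ul: "u n (- N n) = \<psi> (- N n)" and ur: "u n (N n) = \<psi> (N n)" for n
    using u by blast+
  have upos: "0 < u n x" if "x \<in> {- N n..N n}" for n x
    using u that by blast
  have u\<psi>: "u n x \<le> \<psi> x" if "x \<in> {- N n..N n}" for n x
  proof (rule comparison_bounded_interval[OF _ uc \<psi>cont _ _ _ _ that])
    show "sub_super_pair c {- N n<..<N n} (u n) (\<lambda>x. x * u n x + u n x ^ 3) \<psi> g"
      by unfold_locales (use uode drift_ode_subset[OF \<psi>ode] \<psi>pos \<psi>super in auto)
  qed (auto simp: ul ur \<psi>pos)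
  have udec: "u (Suc n) x \<le> u n x" if "x \<in> {- N n..N n}" for n x
  proof (rule comparison_bounded_interval[OF _ _ uc _ _ _ _ that])
    show "sub_super_pair c {- N n<..<N n} (u (Suc n)) (\<lambda>x. x * u (Suc n) x + u (Suc n) x ^ 3)
        (u n) (\<lambda>x. x * u n x + u n x ^ 3)"
    proof unfold_locales
      show "drift_ode c {- N n<..<N n} (u (Suc n)) (\<lambda>x. x * u (Suc n) x + u (Suc n) x ^ 3)"
        by (rule drift_ode_subset[OF uode]) (use N(3)[of n] in auto)
    qed (use uode upos in auto)
    show "continuous_on {- N n..N n} (u (Suc n))"
      by (rule continuous_on_subset[OF uc[of "Suc n"]]) (use N(3)[of n] in auto)
    show "u (Suc n) (- N n) \<le> u n (- N n)" "u (Suc n) (N n) \<le> u n (N n)"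
      unfolding ul ur using N(1)[of n] N(3)[of n] by (auto intro!: u\<psi>)
  qed (use upos N(1)[of n] in auto)
  \<comment> \<open>The bump vanishes at the ends of the interval, so positivity of \<open>u n\<close> suffices to compare.\<close>
  have uL: "1 \<le> u n (- L)" for n
  proof -
    have sub: "{- L - pi / 2..- L + pi / 2} \<subseteq> {- N n<..<N n}"
      using N(1,2)[of n] \<open>0 < L\<close> by auto
    have "\<eta> (- L) \<le> u n (- L)"
    proof (rule comparison_bounded_interval[of c "- L - pi / 2" "- L + pi / 2" \<eta> f2 "u n"
          "\<lambda>x. x * u n x + u n x ^ 3" "- L"])
      show "sub_super_pair c {- L - pi / 2<..<- L + pi / 2} \<eta> f2 (u n) (\<lambda>x. x * u n x + u n x ^ 3)"
      proof unfold_locales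
        show "drift_ode c {- L - pi / 2<..<- L + pi / 2} \<eta> f2"
          by (rule drift_ode_subset[OF \<eta>ode]) simp
        show "drift_ode c {- L - pi / 2<..<- L + pi / 2} (u n) (\<lambda>x. x * u n x + u n x ^ 3)"
          by (rule drift_ode_subset[OF uode subset_trans[OF _ sub]]) auto
        fix x assume x: "x \<in> {- L - pi / 2<..<- L + pi / 2}"
        have "x \<in> {- N n<..<N n}" using x by (intro subsetD[OF sub]) auto
        then show "0 < u n x" by (intro upos) auto
        show "x * \<eta> x + \<eta> x ^ 3 \<le> f2 x" using x by (intro \<eta>sub) (simp only: greaterThanLessThan_iff, linarith)
      qed auto
      show "continuous_on {- L - pi / 2..- L + pi / 2} \<eta>"
        using drift_ode_continuous_on[OF \<eta>ode] by (rule continuous_on_subset) simp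
      show "continuous_on {- L - pi / 2..- L + pi / 2} (u n)"
        by (rule continuous_on_subset[OF uc[of n]]) (use sub in force)
      have "- L - pi / 2 \<le> N n" "- N n \<le> pi / 2 - L"
        using N(1,2)[of n] \<open>0 < L\<close> pi_gt_zero by linarith+
      then have e: "- L - pi / 2 \<in> {- N n..N n}" "- L + pi / 2 \<in> {- N n..N n}"
        using N(1,2)[of n] \<open>0 < L\<close> by auto
      show "0 < u n (- L - pi / 2)" "0 < u n (- L + pi / 2)" using e by (auto intro: upos)
      then show "\<eta> (- L - pi / 2) \<le> u n (- L - pi / 2)" "\<eta> (- L + pi / 2) \<le> u n (- L + pi / 2)"
        unfolding \<eta>_def by auto
    qed auto
    then show ?thesis unfolding \<eta>_def by simp
  qed
  have u\<phi>: "sqrt (- b - x) \<le> u n x" if x: "- N n \<le> x" "x \<le> - L" for n x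
  proof (rule comparison_bounded_interval[where A = "- N n" and B = "- L"
        and p = "\<lambda>x. sqrt (- b - x)" and q = "u n"])
    show "sub_super_pair c {- N n<..<- L} (\<lambda>x. sqrt (- b - x)) f1 (u n) (\<lambda>x. x * u n x + u n x ^ 3)"
    proof unfold_locales
      show "drift_ode c {- N n<..<- L} (\<lambda>x. sqrt (- b - x)) f1"
        by (rule drift_ode_subset[OF \<phi>ode]) (auto simp: L_def)
      show "drift_ode c {- N n<..<- L} (u n) (\<lambda>x. x * u n x + u n x ^ 3)"
        by (rule drift_ode_subset[OF uode]) (use N(1)[of n] \<open>0 < L\<close> in auto)
      fix x assume x: "x \<in> {- N n<..<- L}"
      show "0 < u n x" using x N(1)[of n] \<open>0 < L\<close> by (intro upos) auto
      show "x * sqrt (- b - x) + sqrt (- b - x) ^ 3 \<le> f1 x"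
        using x by (intro \<phi>sub) (auto simp: L_def)
    qed auto
    show "continuous_on {- N n..- L} (\<lambda>x. sqrt (- b - x))" by (intro continuous_intros)
    show "continuous_on {- N n..- L} (u n)"
      by (rule continuous_on_subset[OF uc[of n]]) (use N(1)[of n] \<open>0 < L\<close> in auto)
    show "0 < u n (- N n)" "0 < u n (- L)" using ul[of n] \<psi>pos uL[of n] by auto
    show "sqrt (- b - - L) \<le> u n (- L)" using uL[of n] by (simp add: L_def)
    show "sqrt (- b - - N n) \<le> u n (- N n)"
      unfolding ul \<psi>_def using hlow[of "- N n"] \<open>0 < b\<close> by simp
  qed (use x in auto)
  have "\<exists>l. (\<lambda>n. u n x) \<longlonglongrightarrow> l" for x
  proof -
    define m where "m = nat \<lceil>\<bar>x\<bar>\<rceil>"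
    have x: "x \<in> {- N (k + m)..N (k + m)}" for k
    proof -
      have "\<bar>x\<bar> \<le> real m" unfolding m_def by linarith
      then show ?thesis unfolding N_def using \<open>0 < L\<close> by auto
    qed
    have "decseq (\<lambda>k. u (k + m) x)"
      using udec[OF x] by (intro decseq_SucI) simp
    moreover have "\<forall>k. 0 \<le> u (k + m) x" using upos[OF x] less_imp_le by blast
    ultimately obtain l where "(\<lambda>k. u (k + m) x) \<longlonglongrightarrow> l" using decseq_convergent by blast
    then have "(\<lambda>n. u n x) \<longlonglongrightarrow> l" by (rule LIMSEQ_offset[where f = "\<lambda>n. u n x"])
    then show ?thesis ..
  qed
  then have "\<forall>x. \<exists>l. (\<lambda>n. u n x) \<longlonglongrightarrow> l" by blast
  from choice[OF this] obtain v where v: "(\<lambda>n. u n x) \<longlonglongrightarrow> v x" for x by blast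
  have inN: "\<forall>\<^sub>F n in sequentially. x \<in> {- N n..N n}" for x
  proof (rule eventually_sequentiallyI[of "nat \<lceil>\<bar>x\<bar>\<rceil>"])
    fix n assume "nat \<lceil>\<bar>x\<bar>\<rceil> \<le> n"
    then have "\<bar>x\<bar> \<le> real n" by linarith
    then show "x \<in> {- N n..N n}" unfolding N_def using \<open>0 < L\<close> by auto
  qed
  have v0: "0 \<le> v x" for x
    by (rule tendsto_lowerbound[OF v]) (use inN[of x] upos less_imp_le in \<open>auto elim!: eventually_mono\<close>)
  have v\<psi>: "v x \<le> \<psi> x" for x
    by (rule tendsto_upperbound[OF v]) (use inN[of x] u\<psi> in \<open>auto elim!: eventually_mono\<close>)
  have v\<phi>: "sqrt (- b - x) \<le> v x" if "x \<le> - L" for x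
    by (rule tendsto_lowerbound[OF v]) (use inN[of x] u\<phi> that in \<open>auto elim!: eventually_mono\<close>)
  have vode: "drift_ode c {- N m<..<N m} v (\<lambda>x. x * v x + v x ^ 3)" for m
  proof -
    define M where "M = \<psi> (- N m)"
    have M: "0 < M" unfolding M_def by (rule \<psi>pos)
    have sub: "{- N m..N m} \<subseteq> {- N (k + m)..N (k + m)}" for k
      using Nmono[of m "k + m"] by auto
    have subi: "{- N m<..<N m} \<subseteq> {- N (k + m)<..<N (k + m)}" for k
      using Nmono[of m "k + m"] by auto
    have ub: "\<bar>u (k + m) x\<bar> \<le> M" if "x \<in> {- N m..N m}" for k x
    proof -
      have x: "x \<in> {- N (k + m)..N (k + m)}" using sub that by blast
      have "\<psi> x \<le> M" unfolding M_def using that by (intro \<psi>anti) auto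
      then show ?thesis using u\<psi>[OF x] upos[OF x] by linarith
    qed
    have vm: "(\<lambda>k. u (k + m) x) \<longlonglongrightarrow> v x" for x
      using LIMSEQ_ignore_initial_segment[OF v] .
    have "continuous_on {- N m..N m} v \<and> drift_ode c {- N m<..<N m} v (\<lambda>x. x * v x + v x ^ 3)"
    proof (rule drift_ode_limit[where u = "\<lambda>k. u (k + m)" and M = "M + N m * M + M ^ 3"])
      show "- N m < N m" using N(1)[of m] by simp
      show c: "continuous_on {- N m..N m} (u (k + m))" for k
        by (rule continuous_on_subset[OF uc sub])
      show "continuous_on {- N m..N m} (\<lambda>x. x * u (k + m) x + u (k + m) x ^ 3)" for k
        by (intro continuous_intros c)
      show "drift_ode c {- N m<..<N m} (u (k + m)) (\<lambda>x. x * u (k + m) x + u (k + m) x ^ 3)" for k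
        by (rule drift_ode_subset[OF uode subi])
      fix x assume x: "x \<in> {- N m..N m}"
      have pos: "0 \<le> N m * M" "0 \<le> M ^ 3" using M N(1)[of m] by auto
      show "\<bar>u (k + m) x\<bar> \<le> M + N m * M + M ^ 3" for k using ub[OF x, of k] pos by linarith
      show "\<bar>x * u (k + m) x + u (k + m) x ^ 3\<bar> \<le> M + N m * M + M ^ 3" for k
      proof -
        have "\<bar>x * u (k + m) x\<bar> \<le> N m * M"
          unfolding abs_mult using x ub[OF x] by (intro mult_mono) auto
        moreover have "\<bar>u (k + m) x ^ 3\<bar> \<le> M ^ 3"
          unfolding power_abs using ub[OF x] by (intro power_mono) auto
        ultimately show ?thesis using M by linarith
      qed
      show "(\<lambda>k. u (k + m) x) \<longlonglongrightarrow> v x" by (rule vm)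
      show "(\<lambda>k. x * u (k + m) x + u (k + m) x ^ 3) \<longlonglongrightarrow> x * v x + v x ^ 3"
        by (intro tendsto_intros vm)
    next
      assume "continuous_on {- N m..N m} v"
      then show "continuous_on {- N m..N m} (\<lambda>x. x * v x + v x ^ 3)" by (intro continuous_intros)
    qed
    then show ?thesis by blast
  qed
  have inNi: "\<exists>m. x \<in> {- N m<..<N m}" for x
  proof -
    obtain n where "\<bar>x\<bar> \<le> real n" using real_arch_simple by blast
    then have "x \<in> {- N n<..<N n}" unfolding N_def using \<open>0 < L\<close> by auto
    then show ?thesis ..
  qed
  have vode: "drift_ode c UNIV v (\<lambda>x. x * v x + v x ^ 3)"
    unfolding drift_ode_def using vode inNi unfolding drift_ode_def by blast
  moreover have "0 < v x" for x
  proof (rule ccontr)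
    assume "\<not> 0 < v x"
    then have z: "v x = 0" using v0[of x] by simp
    define y where "y = min (x - 1) (- L)"
    have "v y = 0"
      by (rule zero_propagates_left[of c "y - 1" "x + 1" v x])
         (use v0 z drift_ode_subset[OF vode] in \<open>auto simp: y_def\<close>)
    moreover have "0 < sqrt (- b - y)" unfolding y_def L_def by auto
    moreover have "sqrt (- b - y) \<le> v y" by (rule v\<phi>) (simp add: y_def)
    ultimately show False by simp
  qed
  moreover have "((\<lambda>x. v x - sqrt (- x)) \<longlongrightarrow> 0) at_bot"
  proof (rule tendsto_sandwich)
    show "\<forall>\<^sub>F x in at_bot. sqrt (- b - x) - sqrt (- x) \<le> v x - sqrt (- x)"
      using eventually_le_at_bot[of "- L"] by eventually_elim (use v\<phi> in auto)
    show "\<forall>\<^sub>F x in at_bot. v x - sqrt (- x) \<le> \<psi> x - sqrt (- x)"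
      using v\<psi> by simp
    show "((\<lambda>x. sqrt (- b - x) - sqrt (- x)) \<longlongrightarrow> 0) at_bot" by real_asymp
    show "((\<lambda>x. \<psi> x - sqrt (- x)) \<longlongrightarrow> 0) at_bot"
      unfolding \<psi>_def h_def by real_asymp
  qed
  moreover have "(v \<longlongrightarrow> 0) at_top"
  proof (rule tendsto_sandwich)
    show "\<forall>\<^sub>F x in at_top. 0 \<le> v x" using v0 by simp
    show "\<forall>\<^sub>F x in at_top. v x \<le> \<psi> x" using v\<psi> by simp
    show "(\<psi> \<longlongrightarrow> 0) at_top" unfolding \<psi>_def h_def by real_asymp
  qed simp
  ultimately show ?thesis by blast
qed

section \<open>Monotonicity and uniqueness\<close>

lemma ratio_of_sqrt_asymptotics:
  fixes p q :: "real \<Rightarrow> real"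
  assumes p: "((\<lambda>x. p x - sqrt (- x)) \<longlongrightarrow> 0) at_bot" and q: "((\<lambda>x. q x - sqrt (- x)) \<longlongrightarrow> 0) at_bot"
  shows "((\<lambda>x. p x / q x) \<longlongrightarrow> 1) at_bot"
proof -
  have inv: "((\<lambda>x. inverse (sqrt (- x))) \<longlongrightarrow> 0) at_bot" by real_asymp
  have pos: "eventually (\<lambda>x::real. 0 < sqrt (- x)) at_bot"
    using eventually_gt_at_bot[of 0] by eventually_elim simp
  have one: "((\<lambda>x. u x / sqrt (- x)) \<longlongrightarrow> 1) at_bot"
    if u: "((\<lambda>x. u x - sqrt (- x)) \<longlongrightarrow> 0) at_bot" for u :: "real \<Rightarrow> real"
  proof -
    have "((\<lambda>x. (u x - sqrt (- x)) * inverse (sqrt (- x)) + 1) \<longlongrightarrow> 0 * 0 + 1) at_bot"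
      by (intro tendsto_intros u inv)
    moreover have "\<forall>\<^sub>F x in at_bot. (u x - sqrt (- x)) * inverse (sqrt (- x)) + 1 = u x / sqrt (- x)"
      using pos by eventually_elim (simp add: field_simps)
    ultimately show ?thesis using Lim_transform_eventually by fastforce
  qed
  have "((\<lambda>x. (p x / sqrt (- x)) / (q x / sqrt (- x))) \<longlongrightarrow> 1 / 1) at_bot"
    by (intro tendsto_divide one p q) simp
  moreover have "\<forall>\<^sub>F x in at_bot. (p x / sqrt (- x)) / (q x / sqrt (- x)) = p x / q x"
    using pos by eventually_elim simp
  ultimately show ?thesis using Lim_transform_eventually by fastforce
qed

text \<open>
  The translate \<open>v (x + h)\<close> with \<open>h \<ge> 0\<close> is a subsolution with the same asymptotics, hence lies
  below \<open>v\<close>.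
\<close>

lemma positive_solution_antimono:
  assumes ode: "drift_ode c UNIV v (\<lambda>x. x * v x + v x ^ 3)" and pos: "\<And>x. 0 < v x"
    and left: "((\<lambda>x. v x - sqrt (- x)) \<longlongrightarrow> 0) at_bot" and right: "(v \<longlongrightarrow> 0) at_top"
  shows "antimono v"
proof (rule antimonoI)
  fix x y :: real assume "x \<le> y"
  define h where "h = y - x"
  have h: "0 \<le> h" "y = x + h" using \<open>x \<le> y\<close> by (auto simp: h_def)
  have "v (x + h) \<le> v x"
  proof (rule comparison_real_line[OF drift_ode_shift[OF ode] pos _ ode pos order.refl])
    show "z * v (z + h) + v (z + h) ^ 3 \<le> (z + h) * v (z + h) + v (z + h) ^ 3" for z
      using h pos[of "z + h"] by (simp add: distrib_right)
    have "filterlim (\<lambda>z. z + h) at_bot at_bot" by real_asymp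
    then have "((\<lambda>z. v (z + h) - sqrt (- (z + h))) \<longlongrightarrow> 0) at_bot"
      by (rule filterlim_compose[OF left])
    moreover have "((\<lambda>z. sqrt (- (z + h)) - sqrt (- z)) \<longlongrightarrow> 0) at_bot" by real_asymp
    ultimately have "((\<lambda>z. (v (z + h) - sqrt (- (z + h))) + (sqrt (- (z + h)) - sqrt (- z)))
        \<longlongrightarrow> 0 + 0) at_bot"
      by (rule tendsto_add)
    then have "((\<lambda>z. v (z + h) - sqrt (- z)) \<longlongrightarrow> 0) at_bot" by simp
    then show "((\<lambda>z. v (z + h) / v z) \<longlongrightarrow> 1) at_bot"
      by (rule ratio_of_sqrt_asymptotics[OF _ left])
    have "filterlim (\<lambda>z. z + h) at_top at_top" by real_asymp
    then show "((\<lambda>z. v (z + h)) \<longlongrightarrow> 0) at_top"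
      by (rule filterlim_compose[OF right])
  qed
  then show "v y \<le> v x" using h by simp
qed

text \<open>
  A zero would make the solution vanish everywhere to its left, against the growth of
  \<open>sqrt (- x)\<close>.
\<close>

lemma decreasing_solution_pos:
  assumes ode: "drift_ode c UNIV u (\<lambda>x. x * u x + u x ^ 3)" and anti: "antimono u"
    and left: "((\<lambda>x. u x - sqrt (- x)) \<longlongrightarrow> 0) at_bot" and right: "(u \<longlongrightarrow> 0) at_top"
  shows "0 < u x"
proof (rule ccontr)
  have nn: "0 \<le> u x" for x
    by (rule tendsto_upperbound[OF right])
       (use anti in \<open>auto simp: antimono_def eventually_at_top_linorder\<close>)
  assume "\<not> 0 < u x"
  then have z: "u x = 0" using nn[of x] by simp
  have zero: "u y = 0" if "y < x" for y
    by (rule zero_propagates_left[of c "y - 1" "x + 1" u x])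
       (use that nn z drift_ode_subset[OF ode] in auto)
  have "\<forall>\<^sub>F y in at_bot. u y - sqrt (- y) = - sqrt (- y)"
    using eventually_gt_at_bot[of x] by eventually_elim (simp add: zero)
  then have "((\<lambda>y. - sqrt (- y)) \<longlongrightarrow> 0) at_bot"
    by (rule Lim_transform_eventually[OF left])
  moreover have "filterlim (\<lambda>y::real. - sqrt (- y)) at_bot at_bot" by real_asymp
  ultimately show False
    using not_tendsto_and_filterlim_at_infinity filterlim_at_bot_imp_at_infinity
      trivial_limit_at_bot_linorder by blast
qed

lemma stationary_solution_iff_drift_ode:
  "stationary_solution c u \<longleftrightarrow> drift_ode c UNIV u (\<lambda>x. x * u x + u x ^ 3)"
proof
  assume "stationary_solution c u"
  then obtain u' u'' where u: "\<And>x. (u has_real_derivative u' x) (at x)"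
      "\<And>x. (u' has_real_derivative u'' x) (at x)" "\<And>x. u'' x + c * u' x - x * u x - u x ^ 3 = 0"
    unfolding stationary_solution_iff_ode by blast
  have "u'' x = (x * u x + u x ^ 3) - c * u' x" for x using u(3)[of x] by linarith
  then show "drift_ode c UNIV u (\<lambda>x. x * u x + u x ^ 3)"
    using u(1,2) by (intro drift_odeI[where u' = u']) auto
next
  assume "drift_ode c UNIV u (\<lambda>x. x * u x + u x ^ 3)"
  then show "stationary_solution c u"
    unfolding stationary_solution_iff_ode drift_ode_def
    by (intro exI[of _ "deriv u"] exI[of _ "\<lambda>x. x * u x + u x ^ 3 - c * deriv u x"]) auto
qed

theorem theorem1p1:
  fixes c :: real
  shows "\<exists>!u :: real \<Rightarrow> real.
           stationary_solution c u \<and> antimono u \<and>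
           ((\<lambda>x. u x - sqrt (- x)) \<longlongrightarrow> 0) at_bot \<and>
           (u \<longlongrightarrow> 0) at_top"
  unfolding stationary_solution_iff_drift_ode
proof (rule ex_ex1I)
  show "\<exists>u. drift_ode c UNIV u (\<lambda>x. x * u x + u x ^ 3) \<and> antimono u \<and>
           ((\<lambda>x. u x - sqrt (- x)) \<longlongrightarrow> 0) at_bot \<and> (u \<longlongrightarrow> 0) at_top"
    using exists_positive_solution positive_solution_antimono by blast
next
  fix u v :: "real \<Rightarrow> real"
  assume u: "drift_ode c UNIV u (\<lambda>x. x * u x + u x ^ 3) \<and> antimono u \<and>
           ((\<lambda>x. u x - sqrt (- x)) \<longlongrightarrow> 0) at_bot \<and> (u \<longlongrightarrow> 0) at_top"
    and v: "drift_ode c UNIV v (\<lambda>x. x * v x + v x ^ 3) \<and> antimono v \<and>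
           ((\<lambda>x. v x - sqrt (- x)) \<longlongrightarrow> 0) at_bot \<and> (v \<longlongrightarrow> 0) at_top"
  have le: "p x \<le> q x"
    if p: "drift_ode c UNIV p (\<lambda>x. x * p x + p x ^ 3) \<and> antimono p \<and>
           ((\<lambda>x. p x - sqrt (- x)) \<longlongrightarrow> 0) at_bot \<and> (p \<longlongrightarrow> 0) at_top"
      and q: "drift_ode c UNIV q (\<lambda>x. x * q x + q x ^ 3) \<and> antimono q \<and>
           ((\<lambda>x. q x - sqrt (- x)) \<longlongrightarrow> 0) at_bot \<and> (q \<longlongrightarrow> 0) at_top"
    for p q :: "real \<Rightarrow> real" and x
    using p q by (intro comparison_real_line[where f = "\<lambda>x. x * p x + p x ^ 3"
          and g = "\<lambda>x. x * q x + q x ^ 3" and p = p and q = q and c = c]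
        decreasing_solution_pos ratio_of_sqrt_asymptotics) auto
  show "u = v" using le[OF u v] le[OF v u] by (intro ext antisym) auto
qed

end
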